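(* There are exactly two minimal reversible exclusion sets over the Gaussian integers $\mathbb{Z}[i]$ of length two, namely $\overline{U_1}$ and $\overline{U_2}$, where \[ U_1=\left\{\begin{aligned} &\{1,1\}, \{1,2\}, \{1,3\}, \{1,i\}, \{1,1+i\}, \{1,2+i\}, \{1,3+i\},\\ &\{1,1+2i\}, \{1,2+2i\}, \{1+i,1-i\}, \{1+i,2\}, \{1+i,2-i\} \end{aligned}\right\}, \] \[ U_2=\left\{\begin{aligned} &\{1,1\}, \{1,2\}, \{1,3\}, \{1,i\}, \{1,1+i\}, \{1,2+i\}, \{1,3+i\},\\ &\{1+i,2+i\},\{1,2+2i\}, \{1+i,1-i\}, \{1+i,2\}, \{1+i,2-i\} \end{aligned}\right\}. \]
   Context: Continued fractions. For a sequence of Gaussian integers $b_0,b_1,\dots$, the (negative) Gaussian integer continued fraction $[b_0,b_1,\dots]$ is $b_0-\cfrac{1}{b_1-\cfrac{1}{b_2-\cdots}}$. Put $A_0=1$, $B_0=0$, $A_1=b_0$, $B_1=1$ and $A_{n+1}=b_nA_n-A_{n-1}$, $B_{n+1}=b_nB_n-B_{n-1}$ for $n\geq 1$. The convergents are $A_n/B_n\in\widehat{\mathbb{C}}=\mathbb{C}\cup\{\infty\}$. The continued fraction converges if its sequence of convergents converges in the topological space $\widehat{\mathbb{C}}$ (the Riemann sphere; convergence to $\infty$ is permitted), and otherwise it diverges. Words. A word is a nonempty finite sequence of Gaussian integers $(x_1,\dots,x_n)$; a word of length one is written $x_1$. A word $x$ is a substring of $[b_0,b_1,\dots]$, or of a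 word $(b_0,\dots,b_m)$, if $x=(b_r,b_{r+1},\dots,b_s)$ for some $0\leq r\leq s$ (contiguous). A set of words $X$ is without redundancy if no element of $X$ is a substring of another element of $X$. For a unit $u\in\{\pm1,\pm i\}$, the operation $X\to X^u$ replaces each word $(x_1,x_2,\dots,x_n)$ of $X$ with $(ux_1,u^{-1}x_2,\dots,u^{(-1)^{n-1}}x_n)$. $\overline{X}$ is the smallest set of words in $\mathbb{Z}[i]$ that contains $X$ and the one-letter word $0$ and is closed under (entrywise) complex conjugation and under all operations $X\to X^u$, for every unit $u$. $X$ is symmetric if $X=\overline{X}$. Exclusion sets. For a symmetric set $X$, $\mathrm{Ex}(X)$ is the set of all infinite Gaussian integer continued fractions $[b_0,b_1,\dots]$ for which every tail $[b_n,b_{n+1},\dots]$ contains a substring from $X$. A symmetric set $X$ without redundancy is an exclusion set over $\mathbb{Z}[i]$ if $\mathrm{Ex}(X)$ contains every divergent Gaussian integer continued fraction. A reversible exclusion set is an exclusion set that is closed under reversal of words. The length of an exclusion set is the supremum of the lengths of its words. Finite exclusion sets are partially ordered by $X\preceq Y$ iff $\mathrm{Ex}(X)\subseteq \mathrm{Ex}(Y)$. A minimal reversible exclusion set of length two is a minimal element of the poset of all finite reversible exclusion sets of length two. Notation. A reversible set of words of length at most two is written as a collection of multisets: the multiset $\{a,b\}$ stands for both words $(a,b)$ and $(b,a)$. *)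

theory Defs
  imports "HOL-Analysis.Analysis" "HOL-Library.Multiset" "HOL-Library.Sublist"
    "HOL-Library.Extended_Nat"
begin

section \<open>Gaussian integer continued fractions\<close>

definition gaussian_ints :: "complex set" where
  "gaussian_ints = {z. Re z \<in> \<int> \<and> Im z \<in> \<int>}"

definition gaussian_units :: "complex set" where
  "gaussian_units = {1, -1, \<i>, -\<i>}"

text \<open>A sequence b stands for the negative continued fraction
  b 0 - 1 / (b 1 - 1 / (b 2 - ...)).  The convergent with index 0 is 1/0, that is, infinity;
  the one with index 1 is b 0.\<close>

definition gaussian_cfs :: "(nat \<Rightarrow> complex) set" where
  "gaussian_cfs = {b. \<forall>n. b n \<in> gaussian_ints}"

fun cf_num :: "(nat \<Rightarrow> complex) \<Rightarrow> nat \<Rightarrow> complex" where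
  "cf_num b 0 = 1"
| "cf_num b (Suc 0) = b 0"
| "cf_num b (Suc (Suc n)) = b (Suc n) * cf_num b (Suc n) - cf_num b n"

fun cf_denom :: "(nat \<Rightarrow> complex) \<Rightarrow> nat \<Rightarrow> complex" where
  "cf_denom b 0 = 0"
| "cf_denom b (Suc 0) = 1"
| "cf_denom b (Suc (Suc n)) = b (Suc n) * cf_denom b (Suc n) - cf_denom b n"

text \<open>The Riemann sphere is the one-point compactification of the plane; \<^term>\<open>None\<close> is the
  point at infinity.  Numerator and denominator of a convergent never vanish together.\<close>

abbreviation riemann_sphere :: "complex option topology" where
  "riemann_sphere \<equiv> Alexandroff_compactification euclidean"

definition cf_convergent :: "(nat \<Rightarrow> complex) \<Rightarrow> nat \<Rightarrow> complex option" where
  "cf_convergent b n =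
     (if cf_denom b n = 0 then None else Some (cf_num b n / cf_denom b n))"

definition cf_converges :: "(nat \<Rightarrow> complex) \<Rightarrow> bool" where
  "cf_converges b \<longleftrightarrow> (\<exists>l. limitin riemann_sphere (cf_convergent b) l sequentially)"


section \<open>Words\<close>

definition words :: "complex list set" where
  "words = {w. w \<noteq> [] \<and> set w \<subseteq> gaussian_ints}"

definition substring_of_seq :: "complex list \<Rightarrow> (nat \<Rightarrow> complex) \<Rightarrow> bool" where
  "substring_of_seq w b \<longleftrightarrow> (\<exists>r. w = map b [r..<r + length w])"

definition without_redundancy :: "complex list set \<Rightarrow> bool" where
  "without_redundancy X \<longleftrightarrow> (\<forall>x\<in>X. \<forall>y\<in>X. x \<noteq> y \<longrightarrow> \<not> sublist x y)"

text \<open>Letters are multiplied alternately by \<^term>\<open>u\<close> and \<^term>\<open>inverse u\<close>, starting with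
  \<^term>\<open>u\<close>.\<close>

fun twist :: "complex \<Rightarrow> complex list \<Rightarrow> complex list" where
  "twist u [] = []"
| "twist u (x # xs) = u * x # twist (inverse u) xs"

inductive_set sym_closure :: "complex list set \<Rightarrow> complex list set"
  for X :: "complex list set" where
  base: "w \<in> X \<Longrightarrow> w \<in> sym_closure X"
| zero: "[0] \<in> sym_closure X"
| conj: "w \<in> sym_closure X \<Longrightarrow> map cnj w \<in> sym_closure X"
| twist: "w \<in> sym_closure X \<Longrightarrow> u \<in> gaussian_units \<Longrightarrow> twist u w \<in> sym_closure X"

definition symmetric_word_set :: "complex list set \<Rightarrow> bool" where
  "symmetric_word_set X \<longleftrightarrow> X \<subseteq> words \<and> X = sym_closure X"


section \<open>Exclusion sets\<close>

definition Ex_set :: "complex list set \<Rightarrow> (nat \<Rightarrow> complex) set" where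
  "Ex_set X = {b \<in> gaussian_cfs. \<forall>n. \<exists>x\<in>X. substring_of_seq x (\<lambda>k. b (n + k))}"

definition exclusion_set :: "complex list set \<Rightarrow> bool" where
  "exclusion_set X \<longleftrightarrow> symmetric_word_set X \<and> without_redundancy X \<and>
     (\<forall>b\<in>gaussian_cfs. \<not> cf_converges b \<longrightarrow> b \<in> Ex_set X)"

definition reversible_exclusion_set :: "complex list set \<Rightarrow> bool" where
  "reversible_exclusion_set X \<longleftrightarrow> exclusion_set X \<and> (\<forall>x\<in>X. rev x \<in> X)"

definition word_set_length :: "complex list set \<Rightarrow> enat" where
  "word_set_length X = (SUP x\<in>X. enat (length x))"

definition exclusion_le :: "complex list set \<Rightarrow> complex list set \<Rightarrow> bool" where
  "exclusion_le X Y \<longleftrightarrow> Ex_set X \<subseteq> Ex_set Y"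

definition finite_reversible_exclusion_sets :: "enat \<Rightarrow> complex list set set" where
  "finite_reversible_exclusion_sets l =
     {X. finite X \<and> reversible_exclusion_set X \<and> word_set_length X = l}"

definition minimal_reversible_exclusion_set :: "enat \<Rightarrow> complex list set \<Rightarrow> bool" where
  "minimal_reversible_exclusion_set l X \<longleftrightarrow>
     X \<in> finite_reversible_exclusion_sets l \<and>
     (\<forall>Y\<in>finite_reversible_exclusion_sets l. exclusion_le Y X \<longrightarrow> Y = X)"


section \<open>The two sets of words\<close>

text \<open>A collection of multisets stands for the set of all words that arrange one of them.\<close>

definition arrangements :: "complex multiset set \<Rightarrow> complex list set" where
  "arrangements M = {w. mset w \<in> M}"

definition U1 :: "complex list set" where
  "U1 = arrangements
     {{#1, 1#}, {#1, 2#}, {#1, 3#}, {#1, \<i>#}, {#1, 1 + \<i>#}, {#1, 2 + \<i>#}, {#1, 3 + \<i>#},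
      {#1, 1 + 2 * \<i>#}, {#1, 2 + 2 * \<i>#}, {#1 + \<i>, 1 - \<i>#}, {#1 + \<i>, 2#}, {#1 + \<i>, 2 - \<i>#}}"

definition U2 :: "complex list set" where
  "U2 = arrangements
     {{#1, 1#}, {#1, 2#}, {#1, 3#}, {#1, \<i>#}, {#1, 1 + \<i>#}, {#1, 2 + \<i>#}, {#1, 3 + \<i>#},
      {#1 + \<i>, 2 + \<i>#}, {#1, 2 + 2 * \<i>#}, {#1 + \<i>, 1 - \<i>#}, {#1 + \<i>, 2#}, {#1 + \<i>, 2 - \<i>#}}"

end

(*
  Convergence of every continued fraction that avoids the words: to each letter b belong finitely many
  discs containing all tails with first letter b, and for every permitted pair a, b the map
  z \<mapsto> a - 1/z sends each disc of b into a strictly larger disc of a.  Pulled back to the first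
  letter, a disc of the n-th tail has radius 1/K, where K is an integer because disc and matrix have
  Gaussian integer coefficients.  Strict inclusion makes K grow by at least 1 in each step, so the
  nested images shrink at rate 1/n, and so do the oscillations of the convergents.

  Lower bound: for each pair common to U1 and U2 there is a divergent periodic continued fraction all
  of whose consecutive letters form pairs in the orbit of the given one, so an exclusion set of length
  two has to meet the pair.  A word of period 16 with product the identity uses just the orbits of
  {1, 1 + 2i} and {1 + i, 2 + i}, so one of these two has to be met as well.  Hence every exclusion set
  lies above the closure of U1 or that of U2.
*)
theory Submission
  imports Defs
begin

section \<open>Discs under inversion\<close>

text \<open>Many of the inclusions between discs are tangential, so no uniform contraction is
  available: the fraction with all letters 2 contains no excluded pair, yet its convergents (n +
  1)/n approach 1 only at rate 1/n. Integrality of the curvatures replaces contraction.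

  The difference between the two sets is whether the unit disc around 2 + i belongs to the letter 1
  + 2i. If it does, its image under 1 - 1/z fits into no disc of the letter 1, and the pair {1, 1 +
  2i} must be given up. If it does not, then by symmetry the letter 2 + i lacks the unit disc around
  1 + 2i = (2 + i) - (1 - i), which is the one that receives the tails with first letter 1 + i, and
  {1 + i, 2 + i} must be given up. Every other exclusion is common to both choices: it comes from a
  letter of modulus 1 or sqrt 2, around which a unit disc is too large to be inverted into another
  disc of the system.\<close>

lemma inverse_in_cball:
  fixes e w :: complex
  assumes "cmod (w - e) \<le> r" "r < cmod e" "0 \<le> r"
  shows "cmod (1 / w - cnj e / of_real ((cmod e)\<^sup>2 - r\<^sup>2)) \<le> r / ((cmod e)\<^sup>2 - r\<^sup>2)"
proof -
  define D where "D = (cmod e)\<^sup>2 - r\<^sup>2"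
  have D: "D > 0" using assms by (simp add: D_def power_strict_mono)
  have w: "w \<noteq> 0" using assms by auto
  \<comment> \<open>The modulus of \<open>of_real D - cnj e * w\<close>, divided by |w|, is D times
    the distance of 1/w from the claimed centre. The identity therefore turns the claimed bound into
    the hypothesis on |w - e|.\<close>
  have "(cmod (of_real D - cnj e * w))\<^sup>2 - (r * cmod w)\<^sup>2 = D * ((cmod (w - e))\<^sup>2 - r\<^sup>2)"
    unfolding cmod_power2 power_mult_distrib D_def by (simp add: algebra_simps power2_eq_square)
  also have "\<dots> \<le> 0" using D assms by (simp add: mult_le_0_iff power_mono)
  finally have "(cmod (of_real D - cnj e * w))\<^sup>2 \<le> (r * cmod w)\<^sup>2" by linarith
  then have le: "cmod (of_real D - cnj e * w) \<le> r * cmod w"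
    by (rule power2_le_imp_le) (simp add: assms)
  have "1 / w - cnj e / of_real D = (of_real D - cnj e * w) / (of_real D * w)"
    using w D by (simp add: field_simps)
  then have "cmod (1 / w - cnj e / of_real D) = cmod (of_real D - cnj e * w) / (D * cmod w)"
    using D by (simp add: norm_divide norm_mult)
  also have "\<dots> \<le> r * cmod w / (D * cmod w)"
    using le D by (intro divide_right_mono) auto
  also have "\<dots> = r / D" using w by simp
  finally show ?thesis by (simp only: D_def)
qed

text \<open>\<open>disc k \<beta>\<close> has radius \<open>1 / k\<close> and centre \<open>\<beta> / k\<close>; its image under inversion has radius
  \<open>1 / disc_gap k \<beta>\<close>.\<close>

definition disc :: "real \<Rightarrow> complex \<Rightarrow> complex set" where
  "disc k \<beta> = {z. cmod (of_real k * z - \<beta>) \<le> 1}"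

definition disc_gap :: "real \<Rightarrow> complex \<Rightarrow> real" where
  "disc_gap k \<beta> = ((cmod \<beta>)\<^sup>2 - 1) / k"

text \<open>The map \<open>z \<mapsto> a - 1 / z\<close> sends the first disc into the second one and strictly decreases the
  radius.\<close>

definition refines :: "complex \<Rightarrow> real \<times> complex \<Rightarrow> real \<times> complex \<Rightarrow> bool" where
  "refines a D E \<longleftrightarrow> (case D of (k, \<beta>) \<Rightarrow> case E of (l, \<delta>) \<Rightarrow>
     l < disc_gap k \<beta> \<and>
     cmod (of_real l * (of_real (disc_gap k \<beta>) * a - cnj \<beta>) - of_real (disc_gap k \<beta>) * \<delta>)
       \<le> disc_gap k \<beta> - l)"

text \<open>With g = \<open>disc_gap k \<beta>\<close>, the image disc has radius 1/g and centre a -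
  cnj \<beta> / g. The second clause of \<open>refines\<close> is the usual criterion for inclusion,
  |difference of centres| \<le> 1/l - 1/g, multiplied by l g.\<close>

lemma refines_disc:
  assumes "refines a (k, \<beta>) (l, \<delta>)" "0 < k" "0 < l" "z \<in> disc k \<beta>"
  shows "z \<noteq> 0" "a - 1 / z \<in> disc l \<delta>"
proof -
  define g where "g = disc_gap k \<beta>"
  have g: "l < g" "cmod (of_real l * (of_real g * a - cnj \<beta>) - of_real g * \<delta>) \<le> g - l"
    using assms(1) by (auto simp: refines_def g_def)
  have kg: "(cmod \<beta>)\<^sup>2 - 1\<^sup>2 = k * g" using assms(2)
    by (simp add: g_def disc_gap_def)
  have "g > 0" using g assms by simp
  then have "0 < k * g" using assms(2) by simp
  then have "1 < (cmod \<beta>)\<^sup>2" using kg by simp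
  then have b: "1 < cmod \<beta>" using power_le_one[of "cmod \<beta>" 2] by force
  have z: "cmod (of_real k * z - \<beta>) \<le> 1" using assms by (simp add: disc_def)
  show "z \<noteq> 0" using z b by auto
  have "cmod (1 / (of_real k * z) - cnj \<beta> / of_real (k * g)) \<le> 1 / (k * g)"
    using inverse_in_cball[OF z b, unfolded kg] by simp
  then have "k * cmod (1 / (of_real k * z) - cnj \<beta> / of_real (k * g)) \<le> k * (1 / (k * g))"
    using assms by (intro mult_left_mono) auto
  moreover have "k * cmod (1 / (of_real k * z) - cnj \<beta> / of_real (k * g))
      = cmod (of_real k * (1 / (of_real k * z) - cnj \<beta> / of_real (k * g)))"
    using assms by (simp add: norm_mult)
  moreover have "of_real k * (1 / (of_real k * z) - cnj \<beta> / of_real (k * g)) = 1 / z - cnj \<beta> / of_real g"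
    using \<open>z \<noteq> 0\<close> \<open>g > 0\<close> assms by (simp add: field_simps)
  ultimately have inv: "cmod (1 / z - cnj \<beta> / of_real g) \<le> 1 / g"
    using assms by simp
  have "of_real l * (a - 1 / z) - \<delta> =
      (of_real l * (of_real g * a - cnj \<beta>) - of_real g * \<delta>) / of_real g
      - of_real l * (1 / z - cnj \<beta> / of_real g)"
    using \<open>z \<noteq> 0\<close> \<open>g > 0\<close> by (simp add: field_simps)
  then have "cmod (of_real l * (a - 1 / z) - \<delta>) \<le>
      cmod ((of_real l * (of_real g * a - cnj \<beta>) - of_real g * \<delta>) / of_real g)
      + cmod (of_real l * (1 / z - cnj \<beta> / of_real g))"
    by (metis norm_triangle_ineq4)
  also have "\<dots> = cmod (of_real l * (of_real g * a - cnj \<beta>) - of_real g * \<delta>) / g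
      + l * cmod (1 / z - cnj \<beta> / of_real g)"
    using \<open>g > 0\<close> \<open>0 < l\<close> unfolding norm_divide norm_mult by simp
  also have "\<dots> \<le> (g - l) / g + l * (1 / g)"
    using g inv \<open>g > 0\<close> \<open>0 < l\<close>
    by (intro add_mono divide_right_mono mult_left_mono) auto
  also have "\<dots> = 1" using \<open>g > 0\<close> by (simp add: field_simps)
  finally show "a - 1 / z \<in> disc l \<delta>" by (simp add: disc_def)
qed

text \<open>If \<open>T z = (A z - A') / (q z - p)\<close> has determinant of modulus 1, then the image under \<open>T\<close> of
  the disc \<open>(k, \<beta>)\<close> has radius \<open>1 / curv p q (k, \<beta>)\<close>.\<close>

definition curv :: "complex \<Rightarrow> complex \<Rightarrow> real \<times> complex \<Rightarrow> real" where
  "curv p q D = (case D of (k, \<beta>) \<Rightarrow>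
     disc_gap k \<beta> * (cmod q)\<^sup>2 - 2 * Re (\<beta> * q * cnj p) + k * (cmod p)\<^sup>2)"

lemma curv_eq:
  assumes "k > 0"
  shows "k * curv p q (k, \<beta>) = (cmod (\<beta> * q - of_real k * p))\<^sup>2 - (cmod q)\<^sup>2"
proof -
  have "k * curv p q (k, \<beta>) = ((cmod \<beta>)\<^sup>2 - 1) * (cmod q)\<^sup>2 - 2 * k * Re (\<beta> * q * cnj p) + k\<^sup>2 * (cmod p)\<^sup>2"
    using assms by (simp add: curv_def disc_gap_def field_simps power2_eq_square)
  also have "\<dots> = (cmod (\<beta> * q - of_real k * p))\<^sup>2 - (cmod q)\<^sup>2"
    unfolding cmod_power2 by (simp add: algebra_simps power2_eq_square)
  finally show ?thesis .
qed

text \<open>For q \<noteq> 0 the right-hand side says that the pole p/q is at distance more than 1/k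
  from the centre \<beta>/k, so the image of the disc is again a bounded disc.\<close>

lemma curv_pos_iff:
  assumes "k > 0"
  shows "0 < curv p q (k, \<beta>) \<longleftrightarrow> cmod q < cmod (\<beta> * q - of_real k * p)"
proof -
  have "0 < curv p q (k, \<beta>) \<longleftrightarrow> 0 < k * curv p q (k, \<beta>)" using assms
    by (simp add: zero_less_mult_iff)
  also have "\<dots> \<longleftrightarrow> (cmod q)\<^sup>2 < (cmod (\<beta> * q - of_real k * p))\<^sup>2" using curv_eq[OF assms] by simp
  also have "\<dots> \<longleftrightarrow> cmod q < cmod (\<beta> * q - of_real k * p)"
    by (meson norm_ge_zero power_less_imp_less_base power_strict_mono zero_less_numeral)
  finally show ?thesis .
qed

text \<open>If T has denominator q z - p, then T(a - 1/x) has denominator (a q - p) x - q after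
  clearing x. The two curvatures thus belong to nested discs: the image of (l, \<delta>) under T,
  and inside it the image of (k, \<beta>) under the composition.\<close>

lemma curv_refines:
  assumes r: "refines a (k, \<beta>) (l, \<delta>)" and "0 < k" "0 < l" and pos: "0 < curv p q (l, \<delta>)"
    and "q \<noteq> 0"
  shows "curv p q (l, \<delta>) < curv q (a * q - p) (k, \<beta>)"
proof -
  define g where "g = disc_gap k \<beta>"
  define \<eta> where "\<eta> = of_real g * a - cnj \<beta>"
  define E F Q
    where "E = cmod (\<delta> * q - of_real l * p)" and "F = cmod (\<eta> * q - of_real g * p)"
    and "Q = cmod q"
  have g: "l < g" "cmod (of_real l * \<eta> - of_real g * \<delta>) \<le> g - l"
    using r by (auto simp: refines_def g_def \<eta>_def)
  have kg: "(cmod \<beta>)\<^sup>2 = k * g + 1" using assms(2) by (simp add: g_def disc_gap_def)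
  have "(cmod \<beta>)\<^sup>2 * (cmod q)\<^sup>2 = (k * g + 1) * (cmod q)\<^sup>2" using kg by simp
  then have "g * curv q (a * q - p) (k, \<beta>) = F\<^sup>2 - Q\<^sup>2"
    unfolding curv_def F_def Q_def \<eta>_def split_conv g_def[symmetric]
    unfolding cmod_power2 by (simp add: algebra_simps power2_eq_square)
  then have F: "curv q (a * q - p) (k, \<beta>) = (F - Q) * (F + Q) / g"
    using g assms by (simp add: field_simps power2_eq_square)
  have E: "curv p q (l, \<delta>) = (E - Q) * (E + Q) / l"
    using curv_eq[OF \<open>0 < l\<close>, of p q \<delta>] \<open>0 < l\<close>
      unfolding E_def Q_def
    by (simp add: field_simps power2_eq_square)
  have EQ: "E > Q" using pos curv_pos_iff[OF \<open>0 < l\<close>] by (simp add: E_def Q_def)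
  have Q: "Q > 0" using \<open>q \<noteq> 0\<close> by (simp add: Q_def)
  have "of_real g * (\<delta> * q - of_real l * p) = of_real l * (\<eta> * q - of_real g * p) - q * (of_real l * \<eta> - of_real g * \<delta>)"
    by (simp add: algebra_simps)
  then have "cmod (of_real g * (\<delta> * q - of_real l * p)) \<le>
      cmod (of_real l * (\<eta> * q - of_real g * p)) + cmod (q * (of_real l * \<eta> - of_real g * \<delta>))"
    by (metis norm_triangle_ineq4)
  then have "g * E \<le> l * F + Q * cmod (of_real l * \<eta> - of_real g * \<delta>)"
    using g assms by (simp add: norm_mult E_def F_def Q_def)
  also have "\<dots> \<le> l * F + Q * (g - l)" using g Q
    by (intro add_left_mono mult_left_mono) auto
  finally have 1: "g * (E - Q) \<le> l * (F - Q)" by (simp add: algebra_simps)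
  have 2: "E < F"
  proof -
    have "l * (E - Q) < g * (E - Q)" using g EQ by simp
    then have "l * (E - Q) < l * (F - Q)" using 1 by linarith
    then show ?thesis using \<open>0 < l\<close> by simp
  qed
  \<comment> \<open>The curvatures are (E - Q)(E + Q)/l and (F - Q)(F + Q)/g. The factor F - Q is at
    least g/l times E - Q, and F + Q exceeds E + Q; the second factor makes the inequality strict
    even for tangent discs.\<close>
  have "(g * (E - Q)) * (E + Q) < l * (F - Q) * (F + Q)"
  proof -
    have "E + Q < F + Q" using 2 by simp
    moreover have "0 < g * (E - Q)" using g assms EQ by simp
    ultimately show ?thesis using 1 Q EQ by (intro mult_le_less_imp_less) auto
  qed
  then have "((E - Q) * (E + Q)) * g < ((F - Q) * (F + Q)) * l" by (simp only: mult_ac)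
  moreover have "0 < g" using g assms by simp
  ultimately show ?thesis unfolding E F using \<open>0 < l\<close>
    by (metis mult_imp_div_pos_less pos_less_divide_eq times_divide_eq_left)
qed

lemma moebius_denom_nonzero:
  assumes "0 < k" "0 < curv p q (k, \<beta>)" "z \<in> disc k \<beta>"
  shows "q * z - p \<noteq> 0"
proof
  assume "q * z - p = 0"
  then have "\<beta> * q - of_real k * p = - q * (of_real k * z - \<beta>)"
    by (simp add: algebra_simps)
  then have "cmod (\<beta> * q - of_real k * p) = cmod q * cmod (of_real k * z - \<beta>)"
    by (simp add: norm_mult)
  also have "\<dots> \<le> cmod q * 1" using assms(3)
    by (intro mult_left_mono) (auto simp: disc_def)
  finally show False using assms(1,2) curv_pos_iff by fastforce
qed

text \<open>The bound is the diameter of the image disc. Up to an additive constant, q times the map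
  is a unimodular multiple of 1/(q x - p), and the denominators k (q x - p) fill a disc of radius
  |q| around \<beta> q - k p, so \<open>inverse_in_cball\<close> applies.\<close>

lemma moebius_diff_le:
  assumes "0 < k" and pos: "0 < curv p q (k, \<beta>)" and "q \<noteq> 0" and det: "cmod (A * p - A' * q) = 1"
    and z: "z \<in> disc k \<beta>" and w: "w \<in> disc k \<beta>"
  shows "cmod ((A * z - A') / (q * z - p) - (A * w - A') / (q * w - p)) \<le> 2 / curv p q (k, \<beta>)"
proof -
  define e where "e = \<beta> * q - of_real k * p"
  define K where "K = curv p q (k, \<beta>)"
  have K: "(cmod e)\<^sup>2 - (cmod q)\<^sup>2 = k * K" using curv_eq[OF \<open>0 < k\<close>]
    by (simp add: K_def e_def)
  have eq: "cmod q < cmod e" using pos curv_pos_iff[OF \<open>0 < k\<close>] by (simp add: e_def)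
  have inv: "cmod (1 / (of_real k * (q * x - p)) - cnj e / of_real (k * K)) \<le> cmod q / (k * K)"
    if "x \<in> disc k \<beta>" for x
  proof -
    have "of_real k * (q * x - p) - e = q * (of_real k * x - \<beta>)"
      by (simp add: e_def algebra_simps)
    then have "cmod (of_real k * (q * x - p) - e) \<le> cmod q * 1"
      using that by (simp only: norm_mult disc_def mem_Collect_eq mult_left_mono norm_ge_zero)
    then show ?thesis using inverse_in_cball[of "of_real k * (q * x - p)" e "cmod q", unfolded K] eq
      by simp
  qed
  have nz: "q * z - p \<noteq> 0" "q * w - p \<noteq> 0"
    using moebius_denom_nonzero[OF \<open>0 < k\<close> pos] z w by auto
  have "cmod (1 / (of_real k * (q * z - p)) - 1 / (of_real k * (q * w - p)))
      \<le> cmod q / (k * K) + cmod q / (k * K)"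
    using norm_triangle_ineq4[of "1 / (of_real k * (q * z - p)) - cnj e / of_real (k * K)"
        "1 / (of_real k * (q * w - p)) - cnj e / of_real (k * K)"] inv[OF z] inv[OF w]
    by (simp only: diff_diff_eq2 diff_add_cancel)
  moreover have "1 / (of_real k * (q * z - p)) - 1 / (of_real k * (q * w - p))
      = of_real (1 / k) * (1 / (q * z - p) - 1 / (q * w - p))"
    by (simp only: right_diff_distrib of_real_divide of_real_1 times_divide_times_eq mult_1)
  ultimately have "1 / k * cmod (1 / (q * z - p) - 1 / (q * w - p)) \<le> cmod q / (k * K) + cmod q / (k * K)"
    using \<open>0 < k\<close> by (simp only: norm_mult norm_of_real) simp
  then have 1: "cmod (1 / (q * z - p) - 1 / (q * w - p)) \<le> 2 * cmod q / K"
    using \<open>0 < k\<close> by (simp add: field_simps)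
  have *: "q * ((A * x - A') / (q * x - p)) = A + (A * p - A' * q) * (1 / (q * x - p))"
    if "q * x - p \<noteq> 0" for x using that by (simp add: divide_simps) (simp add: algebra_simps)
  have "q * ((A * z - A') / (q * z - p) - (A * w - A') / (q * w - p))
      = (A * p - A' * q) * (1 / (q * z - p) - 1 / (q * w - p))"
    unfolding right_diff_distrib *[OF nz(1)] *[OF nz(2)] by simp
  then have "cmod q * cmod ((A * z - A') / (q * z - p) - (A * w - A') / (q * w - p)) =
      cmod (1 / (q * z - p) - 1 / (q * w - p))"
    using det by (metis norm_mult mult_1)
  with 1 have "cmod q * cmod ((A * z - A') / (q * z - p) - (A * w - A') / (q * w - p)) \<le> cmod q * (2 / K)"
    by (simp add: mult.commute)
  then show ?thesis using \<open>q \<noteq> 0\<close>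
    unfolding K_def by (metis mult_le_cancel_left_pos zero_less_norm_iff)
qed


section \<open>A convergence criterion\<close>

lemma gaussian_ints_closed:
  assumes "z \<in> gaussian_ints" "w \<in> gaussian_ints"
  shows "z + w \<in> gaussian_ints" "z - w \<in> gaussian_ints" "z * w \<in> gaussian_ints" "cnj z \<in> gaussian_ints"
  using assms by (auto simp: gaussian_ints_def)

lemma gaussian_norm_Ints: "z \<in> gaussian_ints \<Longrightarrow> (cmod z)\<^sup>2 \<in> \<int>"
  by (auto simp: gaussian_ints_def cmod_power2)

lemma cf_num_denom_gaussian:
  assumes "b \<in> gaussian_cfs"
  shows "cf_num b n \<in> gaussian_ints" "cf_denom b n \<in> gaussian_ints"
proof -
  have b: "b k \<in> gaussian_ints" for k using assms by (auto simp: gaussian_cfs_def)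
  have "cf_num b n \<in> gaussian_ints \<and> cf_num b (Suc n) \<in> gaussian_ints \<and>
      cf_denom b n \<in> gaussian_ints \<and> cf_denom b (Suc n) \<in> gaussian_ints"
  proof (induction n)
    case 0
    show ?case using b[of 0] by (auto simp: gaussian_ints_def)
  qed (simp add: b gaussian_ints_closed)
  then show "cf_num b n \<in> gaussian_ints" "cf_denom b n \<in> gaussian_ints" by auto
qed

lemma cf_det: "cf_num b (Suc n) * cf_denom b n - cf_num b n * cf_denom b (Suc n) = -1"
  by (induction n) (auto simp: algebra_simps)

lemma curv_Ints:
  assumes "p \<in> gaussian_ints" "q \<in> gaussian_ints" "\<beta> \<in> gaussian_ints" "k \<in> \<int>" "disc_gap k \<beta> \<in> \<int>"
  shows "curv p q (k, \<beta>) \<in> \<int>"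
proof -
  have "\<beta> * q * cnj p \<in> gaussian_ints" using assms by (simp add: gaussian_ints_closed)
  then have "Re (\<beta> * q * cnj p) \<in> \<int>" by (simp add: gaussian_ints_def)
  then show ?thesis unfolding curv_def split_conv
    by (intro Ints_add Ints_diff Ints_mult) (use assms gaussian_norm_Ints in auto)
qed

text \<open>These discs are the Hermitian matrices with rows (k, \<beta>) and (cnj \<beta>,
  \<open>disc_gap k \<beta>\<close>), entries in Z[i], determinant -1 and k > 0. Gaussian integer
  substitutions keep the entries integral, whence \<open>curv_Ints\<close>.\<close>

definition integral_disc :: "real \<times> complex \<Rightarrow> bool" where
  "integral_disc D \<longleftrightarrow> (case D of (k, \<beta>) \<Rightarrow>
     0 < k \<and> k \<in> \<int> \<and> \<beta> \<in> gaussian_ints \<and> disc_gap k \<beta> \<in> \<int>)"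

lemma Ints_less_imp_add1_le: "x \<in> \<int> \<Longrightarrow> y \<in> \<int> \<Longrightarrow> x < y \<Longrightarrow> x + 1 \<le> (y::real)"
  by (auto elim!: Ints_cases)

text \<open>\<open>P n\<close> covers the possible values of the n-th tail by several discs. The
  hypothesis \<open>centre\<close> links each of them to the letter \<open>b n\<close> through at
  most one further disc, so the bound on the diameter of a single image only doubles for distances
  to the image of the letter.\<close>

lemma nested_discs_imp_converges:
  fixes b :: "nat \<Rightarrow> complex" and P :: "nat \<Rightarrow> (real \<times> complex) set"
  assumes b: "b \<in> gaussian_cfs"
    and int: "\<And>n D. D \<in> P n \<Longrightarrow> integral_disc D"
    and step: "\<And>n D. D \<in> P (Suc n) \<Longrightarrow> \<exists>E\<in>P n. refines (b n) D E"
    and centre: "\<And>n k \<beta>. (k, \<beta>) \<in> P n \<Longrightarrow>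
       \<exists>(l, \<delta>)\<in>P n. b n \<in> disc l \<delta> \<and> disc k \<beta> \<inter> disc l \<delta> \<noteq> {}"
    and ne: "\<And>n. P n \<noteq> {}"
  shows "(\<forall>n. cf_denom b (Suc n) \<noteq> 0) \<and> convergent (\<lambda>n. cf_num b n / cf_denom b n)"
proof -
  define A where "A = cf_num b"
  define B where "B = cf_denom b"
  define V where "V n = (\<Union>(k, \<beta>)\<in>P n. disc k \<beta>)" for n
  define T where "T n x = (A (Suc n) * x - A n) / (B (Suc n) * x - B n)" for n x
  have BG: "B n \<in> gaussian_ints" for n using cf_num_denom_gaussian[OF b] by (simp add: B_def)
  have bV: "b n \<in> V n" for n
    using ne[of n] centre[of _ _ n] by (fastforce simp: V_def)
  have curv_int: "curv (B n) (B (Suc n)) D \<in> \<int>" if "D \<in> P m" for D m n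
    using int[OF that] by (cases D) (auto simp: integral_disc_def intro: curv_Ints BG)
  have main: "B (Suc n) \<noteq> 0 \<and> (\<forall>D\<in>P (Suc n). real (Suc n) \<le> curv (B n) (B (Suc n)) D)" for n
  proof (induction n)
    case 0
    \<comment> \<open>\<open>curv 0 1 D\<close> is the gap of D. It is an integer, and it is
      positive because D refines a disc of \<open>P 0\<close>.\<close>
    have "1 \<le> curv 0 1 D" if D: "D \<in> P (Suc 0)" for D
    proof -
      obtain k \<beta> where [simp]: "D = (k, \<beta>)" by (cases D)
      obtain l \<delta> where "(l, \<delta>) \<in> P 0" "refines (b 0) D (l, \<delta>)"
        using step[OF D] by auto
      then have "0 < disc_gap k \<beta>" using int[of "(l, \<delta>)" 0]
        by (auto simp: refines_def integral_disc_def)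
      then show ?thesis using int[OF D] Ints_less_imp_add1_le[of 0 "disc_gap k \<beta>"]
        by (auto simp: curv_def integral_disc_def)
    qed
    then show ?case by (simp add: B_def)
  next
    case (Suc n)
    have rec: "B (Suc (Suc n)) = b (Suc n) * B (Suc n) - B n" by (simp add: B_def)
    obtain l \<delta> where l: "(l, \<delta>) \<in> P (Suc n)" "b (Suc n) \<in> disc l \<delta>"
      using bV[of "Suc n"] by (auto simp: V_def)
    have "0 < curv (B n) (B (Suc n)) (l, \<delta>)" using Suc l by fastforce
    then have "B (Suc n) * b (Suc n) - B n \<noteq> 0"
      using moebius_denom_nonzero l int[OF l(1)] by (auto simp: integral_disc_def)
    then have "B (Suc (Suc n)) \<noteq> 0" by (simp add: rec mult.commute)
    moreover have "real (Suc (Suc n)) \<le> curv (B (Suc n)) (B (Suc (Suc n))) D"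
      if D: "D \<in> P (Suc (Suc n))" for D
    proof -
      obtain k \<beta> where [simp]: "D = (k, \<beta>)" by (cases D)
      obtain l \<delta>
        where E: "(l, \<delta>) \<in> P (Suc n)" "refines (b (Suc n)) D (l, \<delta>)"
          using step[OF D] by auto
      have le: "real (Suc n) \<le> curv (B n) (B (Suc n)) (l, \<delta>)" using Suc E by blast
      have "curv (B n) (B (Suc n)) (l, \<delta>) < curv (B (Suc n)) (B (Suc (Suc n))) D"
        unfolding rec \<open>D = (k, \<beta>)\<close>
        by (rule curv_refines) (use E int[OF E(1)] int[OF D] le Suc in \<open>auto simp: integral_disc_def\<close>)
      then show ?thesis
        using le Ints_less_imp_add1_le[OF curv_int[OF E(1)] curv_int[OF D]] by fastforce
    qed
    ultimately show ?case by blast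
  qed
  have T_step: "T n (b (Suc n) - 1 / x) = T (Suc n) x" if "x \<noteq> 0" for n x
  proof -
    have "T (Suc n) x = (x * (A (Suc n) * (b (Suc n) - 1 / x) - A n)) / (x * (B (Suc n) * (b (Suc n) - 1 / x) - B n))"
      unfolding T_def A_def B_def using that by (simp add: algebra_simps)
    then show ?thesis using that by (simp add: T_def)
  qed
  have V_step: "x \<noteq> 0 \<and> b n - 1 / x \<in> V n" if x: "x \<in> V (Suc n)" for n x
  proof -
    obtain k \<beta> where D: "(k, \<beta>) \<in> P (Suc n)" "x \<in> disc k \<beta>" using x
      by (auto simp: V_def)
    obtain l \<delta> where E: "(l, \<delta>) \<in> P n" "refines (b n) (k, \<beta>) (l, \<delta>)"
      using step[OF D(1)] by auto
    then show ?thesis using refines_disc[OF E(2) _ _ D(2)] int[OF D(1)] int[OF E(1)]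
      by (auto simp: V_def integral_disc_def)
  qed
  have conv_eq: "A (Suc (Suc n)) / B (Suc (Suc n)) = T n (b (Suc n))" for n
    by (simp add: T_def A_def B_def mult.commute)
  \<comment> \<open>Cutting the fraction off after a letter means taking this letter itself as the
    value of the last tail. By \<open>bV\<close> it lies in the region of that tail, so convergents
    obey the same nested inclusions as tails.\<close>
  have in_image: "A (Suc (Suc (n + j))) / B (Suc (Suc (n + j))) \<in> T n ` V (Suc n)" for n j
  proof (induction j arbitrary: n)
    case 0
    then show ?case using conv_eq[of n] bV by auto
  next
    case (Suc j)
    obtain x
      where x: "x \<in> V (Suc (Suc n))" "A (Suc (Suc (Suc n + j))) / B (Suc (Suc (Suc n + j))) = T (Suc n) x"
      using Suc[of "Suc n"] by auto
    then have "A (Suc (Suc (n + Suc j))) / B (Suc (Suc (n + Suc j))) = T n (b (Suc n) - 1 / x)"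
      using T_step[of x n] V_step[OF x(1)] by simp
    then show ?case using V_step[OF x(1)] by auto
  qed
  have diff: "cmod (T n x - T n (b (Suc n))) \<le> 4 / real (Suc n)" if x: "x \<in> V (Suc n)"
    for n x
  proof -
    have D: "cmod (T n z - T n w) \<le> 2 / real (Suc n)"
      if "D \<in> P (Suc n)" "D = (k, \<beta>)" "z \<in> disc k \<beta>" "w \<in> disc k \<beta>"
        for D k \<beta> z w
    proof -
      have le: "real (Suc n) \<le> curv (B n) (B (Suc n)) (k, \<beta>)" using main[of n] that
        by blast
      have "cmod (T n z - T n w) \<le> 2 / curv (B n) (B (Suc n)) (k, \<beta>)"
        unfolding T_def
      proof (rule moebius_diff_le)
        show "cmod (A (Suc n) * B n - A n * B (Suc n)) = 1"
          unfolding A_def B_def cf_det by simp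
      qed (use int[OF that(1)] that le main[of n] in \<open>auto simp: integral_disc_def\<close>)
      also have "\<dots> \<le> 2 / real (Suc n)" using le by (intro divide_left_mono) auto
      finally show ?thesis .
    qed
    obtain k \<beta> where k: "(k, \<beta>) \<in> P (Suc n)" "x \<in> disc k \<beta>" using x
      by (auto simp: V_def)
    obtain l \<delta> y
      where l: "(l, \<delta>) \<in> P (Suc n)" "b (Suc n) \<in> disc l \<delta>" "y \<in> disc k \<beta>" "y \<in> disc l \<delta>"
      using centre[OF k(1)] by blast
    have "cmod (T n x - T n y) \<le> 2 / real (Suc n)" using D k l by blast
    moreover have "cmod (T n y - T n (b (Suc n))) \<le> 2 / real (Suc n)" using D l by blast
    ultimately have "cmod (T n x - T n (b (Suc n))) \<le> 2 / real (Suc n) + 2 / real (Suc n)"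
      using norm_triangle_le[of "T n x - T n y" "T n y - T n (b (Suc n))"] by simp
    then show ?thesis by (simp add: add_divide_distrib[symmetric])
  qed
  have "Cauchy (\<lambda>n. A (Suc (Suc n)) / B (Suc (Suc n)))"
  proof (rule metric_CauchyI)
    fix e :: real assume "0 < e"
    obtain n where n: "8 / e < real n" using reals_Archimedean2 by blast
    have *: "cmod (A (Suc (Suc m)) / B (Suc (Suc m)) - T n (b (Suc n))) \<le> 4 / real (Suc n)"
      if "m \<ge> n" for m
      using in_image[of n "m - n"] diff that by auto
    have "8 / e < real (Suc n)" using n by simp
    then have "8 / real (Suc n) < e" using \<open>0 < e\<close> by (simp add: field_simps)
    then have half: "4 / real (Suc n) < e / 2" by simp
    have "dist (A (Suc (Suc m)) / B (Suc (Suc m))) (A (Suc (Suc m')) / B (Suc (Suc m'))) < e"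
      if "m \<ge> n" "m' \<ge> n" for m m'
      by (rule dist_triangle_half_r[of "T n (b (Suc n))"])
        (use *[OF that(1)] *[OF that(2)] half in \<open>simp_all add: dist_norm norm_minus_commute\<close>)
    then show "\<exists>M. \<forall>m\<ge>M. \<forall>n\<ge>M. dist (A (Suc (Suc m)) / B (Suc (Suc m))) (A (Suc (Suc n)) / B (Suc (Suc n))) < e"
      by blast
  qed
  then have "convergent (\<lambda>n. A (Suc (Suc n)) / B (Suc (Suc n)))"
    by (simp add: Cauchy_convergent)
  then have "convergent (\<lambda>n. A n / B n)"
    using convergent_Suc_iff[of "\<lambda>n. A (Suc n) / B (Suc n)"] convergent_Suc_iff[of "\<lambda>n. A n / B n"]
    by blast
  then show ?thesis using main by (simp add: A_def B_def)
qed

section \<open>Discs for the tails of a continued fraction\<close>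

lemma gaussian_intsE:
  assumes "z \<in> gaussian_ints"
  obtains x y :: int where "z = Complex (of_int x) (of_int y)"
  using assms by (auto simp: gaussian_ints_def complex_eq_iff elim!: Ints_cases)

lemma cmod_power2_of_int: "(cmod (Complex (of_int x) (of_int y)))\<^sup>2 = of_int (x\<^sup>2 + y\<^sup>2)"
  by (simp add: cmod_power2)

lemma four_le_cmod_power2_of_int_iff:
  "4 \<le> (cmod (Complex (of_int x) (of_int y)))\<^sup>2 \<longleftrightarrow> 4 \<le> x\<^sup>2 + y\<^sup>2"
  unfolding cmod_power2_of_int by (metis of_int_le_iff of_int_numeral)

lemma int_sum_squares_le_3:
  assumes "(x::int)\<^sup>2 + y\<^sup>2 \<le> 3"
  shows "x \<in> {-1, 0, 1}" "y \<in> {-1, 0, 1}"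
proof -
  have "\<bar>z\<bar> < 2" if "z\<^sup>2 \<le> 3" for z :: int
    using power_mono[of 2 "\<bar>z\<bar>" 2] that by force
  moreover have "x\<^sup>2 \<le> 3" "y\<^sup>2 \<le> 3"
    using assms zero_le_power2[of x] zero_le_power2[of y] by linarith+
  ultimately have "\<bar>x\<bar> < 2" "\<bar>y\<bar> < 2" by blast+
  then show "x \<in> {-1, 0, 1}" "y \<in> {-1, 0, 1}" by auto
qed

lemma gaussian_norm_1:
  assumes "a \<in> gaussian_ints" "(cmod a)\<^sup>2 = 1"
  shows "a \<in> gaussian_units"
proof -
  obtain x y :: int where a: "a = Complex (of_int x) (of_int y)" using assms gaussian_intsE by blast
  have xy: "x\<^sup>2 + y\<^sup>2 = 1" using assms(2) unfolding a cmod_power2_of_int by linarith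
  then have "x \<in> {-1, 0, 1}" "y \<in> {-1, 0, 1}" using int_sum_squares_le_3[of x y] by auto
  with xy show ?thesis by (auto simp: a gaussian_units_def complex_eq_iff)
qed

lemma gaussian_norm_2:
  assumes "a \<in> gaussian_ints" "(cmod a)\<^sup>2 = 2"
  obtains u where "u \<in> gaussian_units" "a = u * (1 + \<i>)"
proof -
  obtain x y :: int where a: "a = Complex (of_int x) (of_int y)" using assms gaussian_intsE by blast
  have xy: "x\<^sup>2 + y\<^sup>2 = 2" using assms(2) unfolding a cmod_power2_of_int by linarith
  then have "x \<in> {-1, 0, 1}" "y \<in> {-1, 0, 1}" using int_sum_squares_le_3[of x y] by auto
  with xy have "a = 1 * (1 + \<i>) \<or> a = -1 * (1 + \<i>) \<or> a = \<i> * (1 + \<i>) \<or> a = -\<i> * (1 + \<i>)"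
    by (auto simp: a complex_eq_iff)
  then have "\<exists>u\<in>gaussian_units. a = u * (1 + \<i>)" unfolding gaussian_units_def
    by blast
  then show ?thesis using that by blast
qed

lemma gaussian_unitsD:
  assumes "u \<in> gaussian_units"
  shows "u \<in> gaussian_ints" "cmod u = 1" "u \<noteq> 0" "inverse u \<in> gaussian_units" "inverse u = cnj u" "cnj u \<in> gaussian_units"
    "u * cnj u = 1"
  using assms by (auto simp: gaussian_units_def gaussian_ints_def)

lemma gaussian_norm_cases:
  assumes "a \<in> gaussian_ints" "a \<noteq> 0"
  shows "(cmod a)\<^sup>2 = 1 \<or> (cmod a)\<^sup>2 = 2 \<or> (cmod a)\<^sup>2 \<ge> 4"
proof -
  obtain x y :: int where a: "a = Complex (of_int x) (of_int y)" using assms gaussian_intsE by blast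
  have "x\<^sup>2 + y\<^sup>2 \<noteq> 0" using assms(2)
    by (auto simp: a complex_eq_iff sum_power2_eq_zero_iff)
  moreover have "x\<^sup>2 + y\<^sup>2 \<noteq> 3"
  proof
    assume *: "x\<^sup>2 + y\<^sup>2 = 3"
  then have "x \<in> {-1, 0, 1}" "y \<in> {-1, 0, 1}" using int_sum_squares_le_3[of x y] by auto
    with * show False by auto
  qed
  moreover have "0 \<le> x\<^sup>2 + y\<^sup>2" by simp
  ultimately have "x\<^sup>2 + y\<^sup>2 = 1 \<or> x\<^sup>2 + y\<^sup>2 = 2 \<or> x\<^sup>2 + y\<^sup>2 \<ge> 4" by linarith
  then show ?thesis unfolding a cmod_power2_of_int by linarith
qed

text \<open>The value of a tail with first letter \<open>b\<close> lies in one of the discs \<open>tail_discs t b\<close>. Here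
  \<open>t = False\<close> belongs to the words of \<open>U1\<close> and \<open>t = True\<close> to those of \<open>U2\<close>.\<close>

definition offsets :: "bool \<Rightarrow> complex \<Rightarrow> complex set" where
  "offsets t b = {d \<in> gaussian_ints. 4 \<le> (cmod (b + d))\<^sup>2 \<and>
     ((cmod d)\<^sup>2 \<le> 1 \<or> (cmod d)\<^sup>2 = 2 \<and> (cmod b)\<^sup>2 \<le> 5 \<and>
        \<not> (t \<and> (cmod b)\<^sup>2 = 5 \<and> (cmod (b + d))\<^sup>2 = 5))}"

text \<open>A disc that refines another integral one has gap at least 2. The unit disc around b has
  gap |b|^2 - 1, which is too small when |b|^2 is 1 or 2; the extra discs of radius 1/4 and 1/2 for
  these letters all have gap 2. The condition |b + d|^2 \<ge> 4 in \<open>offsets\<close> gives the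
  unit discs gap at least 3.\<close>

definition tail_discs :: "bool \<Rightarrow> complex \<Rightarrow> (real \<times> complex) set" where
  "tail_discs t b = (\<lambda>d. (1, b + d)) ` offsets t b \<union>
     (if (cmod b)\<^sup>2 = 1 then {(4, 3 * b), (2, b * (2 + \<i>)), (2, b * (2 - \<i>))} else {}) \<union>
     (if (cmod b)\<^sup>2 = 2 then {(2, b * (3 + \<i>) / 2), (2, b * (3 - \<i>) / 2)} else {})"

lemma offset_in_tail_discs: "d \<in> offsets t b \<Longrightarrow> (1, b + d) \<in> tail_discs t b"
  by (simp add: tail_discs_def)

lemma tail_discs_cases:
  assumes "D \<in> tail_discs t b"
  obtains (offset) d where "d \<in> offsets t b" "D = (1, b + d)"
  | (unit) "(cmod b)\<^sup>2 = 1" "D \<in> {(4, 3 * b), (2, b * (2 + \<i>)), (2, b * (2 - \<i>))}"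
  | (norm_2) "(cmod b)\<^sup>2 = 2" "D \<in> {(2, b * (3 + \<i>) / 2), (2, b * (3 - \<i>) / 2)}"
  using assms unfolding tail_discs_def by (auto split: if_splits)

lemma disc_gap_unit:
  assumes "(cmod b)\<^sup>2 = 1" "(k, \<beta>) \<in> {(4, 3 * b), (2, b * (2 + \<i>)), (2, b * (2 - \<i>))}"
  shows "disc_gap k \<beta> = 2"
proof -
  have "(cmod (2 + \<i>))\<^sup>2 = 5" "(cmod (2 - \<i>))\<^sup>2 = 5" by (auto simp: cmod_power2)
  then show ?thesis using assms by (auto simp: disc_gap_def norm_mult power_mult_distrib)
qed

lemma disc_gap_norm_2:
  assumes "(cmod b)\<^sup>2 = 2" "(k, \<beta>) \<in> {(2, b * (3 + \<i>) / 2), (2, b * (3 - \<i>) / 2)}"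
  shows "disc_gap k \<beta> = 2"
proof -
  have "(cmod (3 + \<i>))\<^sup>2 = 10" "(cmod (3 - \<i>))\<^sup>2 = 10" by (auto simp: cmod_power2)
  then have "(cmod (b * (3 + \<i>) / 2))\<^sup>2 = 5" "(cmod (b * (3 - \<i>) / 2))\<^sup>2 = 5"
    using assms by (auto simp: norm_mult norm_divide power_mult_distrib power_divide)
  moreover have "k = 2 \<and> (\<beta> = b * (3 + \<i>) / 2 \<or> \<beta> = b * (3 - \<i>) / 2)"
    using assms(2) by auto
  ultimately have "k = 2" "(cmod \<beta>)\<^sup>2 = 5" by (metis, metis)
  then show ?thesis by (simp add: disc_gap_def)
qed

lemma integral_disc_tail_discs:
  assumes b: "b \<in> gaussian_ints" and D: "D \<in> tail_discs t b"
  shows "integral_disc D"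
  using D
proof (cases rule: tail_discs_cases)
  case (offset d)
  then have "b + d \<in> gaussian_ints" using b gaussian_ints_closed by (auto simp: offsets_def)
  then show ?thesis using gaussian_norm_Ints[of "b + d"] offset
    by (auto simp: integral_disc_def disc_gap_def)
next
  case unit
  obtain k \<beta> where kb: "D = (k, \<beta>)" by (cases D)
  have "3 \<in> gaussian_ints" "2 + \<i> \<in> gaussian_ints" "2 - \<i> \<in> gaussian_ints"
    by (auto simp: gaussian_ints_def)
  then show ?thesis using unit disc_gap_unit[of b k \<beta>] b
    by (auto simp: kb integral_disc_def gaussian_ints_closed)
next
  case norm_2
  obtain k \<beta> where kb: "D = (k, \<beta>)" by (cases D)
  obtain u where u: "u \<in> gaussian_units" "b = u * (1 + \<i>)" using gaussian_norm_2 b norm_2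
    by blast
  have "b * (3 + \<i>) / 2 = u * (1 + 2 * \<i>)" "b * (3 - \<i>) / 2 = u * (2 + \<i>)"
    by (auto simp: u complex_eq_iff)
  moreover have "2 + \<i> \<in> gaussian_ints" "1 + 2 * \<i> \<in> gaussian_ints"
    by (auto simp: gaussian_ints_def)
  ultimately show ?thesis using norm_2 disc_gap_norm_2[of b k \<beta>] gaussian_unitsD(1)[OF u(1)]
    by (auto simp: kb integral_disc_def gaussian_ints_closed)
qed

text \<open>The only discs that miss b are the unit discs with an offset of norm 2. Such an offset
  has both coordinates \<plusminus>1; setting one of them to 0 gives a unit disc that contains b as
  well as the centre b + d.\<close>

lemma tail_discs_centre:
  assumes b: "b \<in> gaussian_ints" and D: "(k, \<beta>) \<in> tail_discs t b"
  shows "\<exists>(l, \<delta>)\<in>tail_discs t b. b \<in> disc l \<delta> \<and> disc k \<beta> \<inter> disc l \<delta> \<noteq> {}"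
proof (cases "b \<in> disc k \<beta>")
  case True
  then show ?thesis using D by blast
next
  case False
  have c: "cmod (\<i> * b) = cmod b" by (simp add: norm_mult)
  from D show ?thesis
  proof (cases rule: tail_discs_cases)
    case (offset d)
    then have "\<not> (cmod d)\<^sup>2 \<le> 1" using False by (auto simp: disc_def abs_square_le_1)
    then have d2: "(cmod d)\<^sup>2 = 2" and dG: "d \<in> gaussian_ints" and bd: "4 \<le> (cmod (b + d))\<^sup>2"
      using offset by (auto simp: offsets_def)
    obtain x y :: int where d: "d = Complex (of_int x) (of_int y)" using dG gaussian_intsE by blast
    obtain p q :: int where b': "b = Complex (of_int p) (of_int q)" using b gaussian_intsE by blast
    have xy: "x\<^sup>2 + y\<^sup>2 = 2" using d2 unfolding d cmod_power2_of_int by linarith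
    then have "x \<in> {-1, 0, 1}" "y \<in> {-1, 0, 1}" using int_sum_squares_le_3[of x y] by auto
    with xy have xy1: "x\<^sup>2 = 1" "y\<^sup>2 = 1" by auto
    have sum: "4 \<le> (p + x)\<^sup>2 + (q + y)\<^sup>2"
    proof -
      have "b + d = Complex (of_int (p + x)) (of_int (q + y))" by (simp add: b' d complex_eq_iff)
      then show ?thesis using bd four_le_cmod_power2_of_int_iff[of "p + x" "q + y"] by simp
    qed
    \<comment> \<open>If both shortened offsets led to a point of norm at most 3, then p + x and q +
      y would both lie in {-1, 0, 1}, and |b + d|^2 would be at most 2.\<close>
    have "4 \<le> (p + x)\<^sup>2 + q\<^sup>2 \<or> 4 \<le> p\<^sup>2 + (q + y)\<^sup>2"
    proof (rule ccontr)
      assume *: "\<not> ?thesis"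
      then have "p + x \<in> {-1, 0, 1}" "q + y \<in> {-1, 0, 1}"
        using int_sum_squares_le_3[of "p + x" q] int_sum_squares_le_3[of p "q + y"] by auto
      then show False using sum by auto
    qed
    then obtain d' where d': "d' \<in> offsets t b" "cmod d' \<le> 1" "cmod (d - d') \<le> 1"
    proof
      assume "4 \<le> (p + x)\<^sup>2 + q\<^sup>2"
      moreover have "b + Complex (of_int x) 0 = Complex (of_int (p + x)) (of_int q)"
        by (simp add: b' complex_eq_iff)
      ultimately have "4 \<le> (cmod (b + Complex (of_int x) 0))\<^sup>2"
        using four_le_cmod_power2_of_int_iff[of "p + x" q] by simp
      moreover have "(cmod (Complex (of_int x) 0))\<^sup>2 = 1"
        using cmod_power2_of_int[of x 0] xy1 by simp
      moreover have "(cmod (d - Complex (of_int x) 0))\<^sup>2 = 1"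
        using cmod_power2_of_int[of 0 y] xy1 by (simp add: d complex_diff)
      moreover have "Complex (of_int x) 0 \<in> gaussian_ints" by (simp add: gaussian_ints_def)
      ultimately show thesis
        by (intro that[of "Complex (of_int x) 0"]) (auto simp: offsets_def power2_eq_1_iff)
    next
      assume "4 \<le> p\<^sup>2 + (q + y)\<^sup>2"
      moreover have "b + Complex 0 (of_int y) = Complex (of_int p) (of_int (q + y))"
        by (simp add: b' complex_eq_iff)
      ultimately have "4 \<le> (cmod (b + Complex 0 (of_int y)))\<^sup>2"
        using four_le_cmod_power2_of_int_iff[of p "q + y"] by simp
      moreover have "(cmod (Complex 0 (of_int y)))\<^sup>2 = 1"
        using cmod_power2_of_int[of 0 y] xy1 by simp
      moreover have "(cmod (d - Complex 0 (of_int y)))\<^sup>2 = 1"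
        using cmod_power2_of_int[of x 0] xy1 by (simp add: d complex_diff)
      moreover have "Complex 0 (of_int y) \<in> gaussian_ints" by (simp add: gaussian_ints_def)
      ultimately show thesis
        by (intro that[of "Complex 0 (of_int y)"]) (auto simp: offsets_def power2_eq_1_iff)
    qed
    have "b \<in> disc 1 (b + d')" using d' by (simp add: disc_def)
    moreover have "b + d \<in> disc 1 (b + d) \<inter> disc 1 (b + d')" using d'
      by (simp add: disc_def)
    ultimately show ?thesis using offset offset_in_tail_discs[OF d'(1)] by blast
  next
    case unit
    then have "cmod b = 1" by (simp add: power2_eq_1_iff) (smt (verit) norm_ge_zero)
    moreover have "4 * b - 3 * b = b" "2 * b - b * (2 + \<i>) = - (\<i> * b)" "2 * b - b * (2 - \<i>) = \<i> * b"
      by (auto simp: algebra_simps)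
    ultimately show ?thesis using unit False c by (auto simp: disc_def)
  next
    case norm_2
    obtain u where u: "u \<in> gaussian_units" "b = u * (1 + \<i>)" using gaussian_norm_2 b norm_2
      by blast
    have "k = 2" "\<beta> = u * (1 + 2 * \<i>) \<or> \<beta> = u * (2 + \<i>)"
      using norm_2 by (auto simp: u complex_eq_iff algebra_simps)
    moreover have "2 * b - u * (1 + 2 * \<i>) = u" "2 * b - u * (2 + \<i>) = u * \<i>"
      by (auto simp: u algebra_simps)
    ultimately show ?thesis using gaussian_unitsD(2)[OF u(1)] False
      by (auto simp: disc_def norm_mult)
  qed
qed

lemma tail_discs_nonempty:
  assumes "b \<in> gaussian_ints" "b \<noteq> 0"
  shows "tail_discs t b \<noteq> {}"
proof -
  have "0 \<in> offsets t b" if "4 \<le> (cmod b)\<^sup>2" using that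
    by (auto simp: offsets_def gaussian_ints_def)
  then show ?thesis using gaussian_norm_cases[OF assms] by (auto simp: tail_discs_def)
qed

text \<open>What is needed for the map \<open>z \<mapsto> a - 1 / z\<close> to send every disc of \<open>b\<close> into a disc of \<open>a\<close>.\<close>

definition admissible :: "bool \<Rightarrow> complex \<Rightarrow> complex \<Rightarrow> bool" where
  "admissible t a b \<longleftrightarrow>
     ((cmod b)\<^sup>2 = 1 \<longrightarrow> 4 \<le> (cmod (a - cnj b))\<^sup>2) \<and>
     ((cmod a)\<^sup>2 = 1 \<longrightarrow> (\<forall>d\<in>offsets t b. a * (b + d) \<notin> {2, 2 + \<i>, 2 - \<i>})) \<and>
     ((cmod b)\<^sup>2 = 2 \<and> (cmod a)\<^sup>2 \<le> 5 \<longrightarrow> 4 \<le> (cmod (a - cnj b))\<^sup>2 \<and>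
        \<not> (t \<and> (cmod a)\<^sup>2 = 5 \<and> (cmod (a - cnj b))\<^sup>2 = 5))"

section \<open>Images of tail discs under one letter\<close>

lemma cmod_le_if_power2_le: "(cmod z)\<^sup>2 \<le> r\<^sup>2 \<Longrightarrow> 0 \<le> r \<Longrightarrow> cmod z \<le> r"
  by (rule power2_le_imp_le)

text \<open>Here w is the centre of a unit disc and g its gap. Up to sign, each left-hand side is
  the expression from \<open>refines\<close> for the letter 1 or 1 + i and one target disc. As |w|^2
  = g + 1, the squares of the two sides differ by a multiple of g times the distance of w from the
  boundary of the half-plane, plus a nonnegative term.\<close>

lemma offset_disc_bounds:
  fixes w :: complex
  defines "g \<equiv> (cmod w)\<^sup>2 - 1"
  assumes "3 \<le> g"
  shows "2 \<le> Im w \<Longrightarrow> cmod (2 * cnj w + \<i> * of_real g) \<le> g - 2"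
    and "Im w \<le> -2 \<Longrightarrow> cmod (2 * cnj w - \<i> * of_real g) \<le> g - 2"
    and "3 \<le> Re w \<Longrightarrow> cmod (of_real g - 4 * cnj w) \<le> g - 4"
    and "Re w \<le> -2 \<Longrightarrow> cmod (cnj w + of_real g) \<le> g - 1"
    and "2 \<le> Im w \<Longrightarrow> cmod (cnj w + \<i> * of_real g) \<le> g - 1"
    and "2 \<le> Re w \<Longrightarrow> cmod (2 * cnj w - of_real g) \<le> g - 2"
proof -
  define x y where "x = Re w" and "y = Im w"
  have g: "x * x + y * y = g + 1" using cmod_power2[of w]
    by (simp add: g_def x_def y_def power2_eq_square)
  show "cmod (2 * cnj w + \<i> * of_real g) \<le> g - 2" if "2 \<le> Im w"
  proof (rule cmod_le_if_power2_le)
    have "(g - 2)\<^sup>2 - (cmod (2 * cnj w + \<i> * of_real g))\<^sup>2 = 4 * g * (y - 2) + 4 * (g + 1 - (x * x + y * y))"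
      unfolding cmod_power2 x_def y_def by (simp add: algebra_simps power2_eq_square)
    also have "\<dots> \<ge> 0" using that \<open>3 \<le> g\<close> g by (simp add: y_def)
    finally show "(cmod (2 * cnj w + \<i> * of_real g))\<^sup>2 \<le> (g - 2)\<^sup>2" by simp
  qed (use \<open>3 \<le> g\<close> in simp)
  show "cmod (2 * cnj w - \<i> * of_real g) \<le> g - 2" if "Im w \<le> -2"
  proof (rule cmod_le_if_power2_le)
    have "(g - 2)\<^sup>2 - (cmod (2 * cnj w - \<i> * of_real g))\<^sup>2 = 4 * g * (-2 - y) + 4 * (g + 1 - (x * x + y * y))"
      unfolding cmod_power2 x_def y_def by (simp add: algebra_simps power2_eq_square)
    also have "\<dots> \<ge> 0" using that \<open>3 \<le> g\<close> g by (simp add: y_def)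
    finally show "(cmod (2 * cnj w - \<i> * of_real g))\<^sup>2 \<le> (g - 2)\<^sup>2" by simp
  qed (use \<open>3 \<le> g\<close> in simp)
  show "cmod (of_real g - 4 * cnj w) \<le> g - 4" if "3 \<le> Re w"
  proof (rule cmod_le_if_power2_le)
    have "(g - 4)\<^sup>2 - (cmod (of_real g - 4 * cnj w))\<^sup>2 = 8 * g * (x - 3) + 16 * (g + 1 - (x * x + y * y))"
      unfolding cmod_power2 x_def y_def by (simp add: algebra_simps power2_eq_square)
    also have "\<dots> \<ge> 0" using that \<open>3 \<le> g\<close> g by (simp add: x_def)
    finally show "(cmod (of_real g - 4 * cnj w))\<^sup>2 \<le> (g - 4)\<^sup>2" by simp
    have "9 \<le> x * x" using that mult_mono[of 3 x 3 x] by (simp add: x_def)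
    then show "0 \<le> g - 4" using g zero_le_square[of y] by linarith
  qed
  show "cmod (cnj w + of_real g) \<le> g - 1" if "Re w \<le> -2"
  proof (rule cmod_le_if_power2_le)
    have "(g - 1)\<^sup>2 - (cmod (cnj w + of_real g))\<^sup>2 = 2 * g * (-2 - x) + g + (g + 1 - (x * x + y * y))"
      unfolding cmod_power2 x_def y_def by (simp add: algebra_simps power2_eq_square)
    also have "\<dots> \<ge> 0" using that \<open>3 \<le> g\<close> g by (simp add: x_def)
    finally show "(cmod (cnj w + of_real g))\<^sup>2 \<le> (g - 1)\<^sup>2" by simp
  qed (use \<open>3 \<le> g\<close> in simp)
  show "cmod (cnj w + \<i> * of_real g) \<le> g - 1" if "2 \<le> Im w"
  proof (rule cmod_le_if_power2_le)
    have "(g - 1)\<^sup>2 - (cmod (cnj w + \<i> * of_real g))\<^sup>2 = 2 * g * (y - 2) + g + (g + 1 - (x * x + y * y))"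
      unfolding cmod_power2 x_def y_def by (simp add: algebra_simps power2_eq_square)
    also have "\<dots> \<ge> 0" using that \<open>3 \<le> g\<close> g by (simp add: y_def)
    finally show "(cmod (cnj w + \<i> * of_real g))\<^sup>2 \<le> (g - 1)\<^sup>2" by simp
  qed (use \<open>3 \<le> g\<close> in simp)
  show "cmod (2 * cnj w - of_real g) \<le> g - 2" if "2 \<le> Re w"
  proof (rule cmod_le_if_power2_le)
    have "(g - 2)\<^sup>2 - (cmod (2 * cnj w - of_real g))\<^sup>2 = 4 * g * (x - 2) + 4 * (g + 1 - (x * x + y * y))"
      unfolding cmod_power2 x_def y_def by (simp add: algebra_simps power2_eq_square)
    also have "\<dots> \<ge> 0" using that \<open>3 \<le> g\<close> g by (simp add: x_def)
    finally show "(cmod (2 * cnj w - of_real g))\<^sup>2 \<le> (g - 2)\<^sup>2" by simp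
  qed (use \<open>3 \<le> g\<close> in simp)
qed

text \<open>For a unit u one has u a' - 1/(cnj u z) = u (a' - 1/z), the effect of
  \<open>twist\<close> on tails. It reduces the letters of norm 1 and 2 to 1 and 1 + i.\<close>

lemma refines_mult_unit:
  assumes "u \<in> gaussian_units" "a = u * a'" "\<beta> = cnj u * \<beta>'" "\<delta> = u * \<delta>'"
    and "l < disc_gap k \<beta>'"
    and "cmod (of_real l * (of_real (disc_gap k \<beta>') * a' - cnj \<beta>') - of_real (disc_gap k \<beta>') * \<delta>')
       \<le> disc_gap k \<beta>' - l"
  shows "refines a (k, \<beta>) (l, \<delta>)"
proof -
  have u: "cmod u = 1" using assms(1) by (rule gaussian_unitsD)
  then have g: "disc_gap k \<beta> = disc_gap k \<beta>'"
    by (simp add: disc_gap_def assms(3) norm_mult)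
  have "of_real l * (of_real (disc_gap k \<beta>') * a - cnj \<beta>) - of_real (disc_gap k \<beta>') * \<delta> =
    u * (of_real l * (of_real (disc_gap k \<beta>') * a' - cnj \<beta>') - of_real (disc_gap k \<beta>') * \<delta>')"
    by (simp add: assms(2-4) algebra_simps)
  then show ?thesis using assms(5,6) u by (simp add: refines_def g norm_mult)
qed

text \<open>After a rotation, the centre w runs through Gaussian integers with |w|^2 \<ge> 4. For
  the letter 1, four half-planes cover all of them except 2, 2 + i and 2 - i, which is the list in
  \<open>admissible\<close>; for 1 + i, four half-planes cover all. For |a| \<ge> 2, the inverse of
  a unit disc centred at distance at least 2 stays in the unit disc around 0, so the disc around a
  itself serves.\<close>

lemma refines_offset:
  assumes a: "a \<in> gaussian_ints" "a \<noteq> 0" and b: "b \<in> gaussian_ints"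
    and adm: "admissible t a b" and d: "d \<in> offsets t b"
  shows "\<exists>E\<in>tail_discs t a. refines a (1, b + d) E"
proof -
  define m where "m = b + d"
  have m: "m \<in> gaussian_ints" "4 \<le> (cmod m)\<^sup>2"
    using d b by (auto simp: m_def offsets_def gaussian_ints_closed)
  define g where "g = disc_gap 1 m"
  have g_eq: "g = (cmod m)\<^sup>2 - 1" by (simp add: g_def disc_gap_def)
  consider "(cmod a)\<^sup>2 = 1" | "(cmod a)\<^sup>2 = 2" | "4 \<le> (cmod a)\<^sup>2"
    using gaussian_norm_cases[OF a] by blast
  then have "\<exists>E\<in>tail_discs t a. refines a (1, m) E"
  proof cases
    case 1
    then have u: "a \<in> gaussian_units" using gaussian_norm_1 a by blast
    have u1: "cmod a = 1" "a * cnj a = 1" "cnj a * a = 1" using gaussian_unitsD[OF u]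
      by (auto simp: mult.commute)
    define w where "w = a * m"
    have mw: "m = cnj a * w" using u1 by (simp add: w_def mult.assoc[symmetric])
    have w: "(cmod w)\<^sup>2 = (cmod m)\<^sup>2" using u1 by (simp add: w_def norm_mult)
    have gw: "disc_gap 1 w = g" "g = (cmod w)\<^sup>2 - 1" by (auto simp: disc_gap_def g_eq w)
    have "w \<in> gaussian_ints" using a m by (simp add: w_def gaussian_ints_closed)
    then obtain x y :: int where xy: "w = Complex (of_int x) (of_int y)" by (rule gaussian_intsE)
    have xy4: "4 \<le> x\<^sup>2 + y\<^sup>2" using m(2) four_le_cmod_power2_of_int_iff
      by (simp add: w[symmetric] xy)
    have "w \<notin> {2, 2 + \<i>, 2 - \<i>}"
      using adm d 1 by (simp add: admissible_def w_def m_def)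
    then have excl: "\<not> (x = 2 \<and> y \<in> {-1, 0, 1})" by (auto simp: xy complex_eq_iff)
    have "y \<ge> 2 \<or> y \<le> -2 \<or> x \<ge> 3 \<or> x \<le> -2"
    proof (rule ccontr)
      assume *: "\<not> ?thesis"
      then have y: "y \<in> {-1, 0, 1}" by auto
      have x: "x \<in> {-1, 0, 1}" using * y excl by auto
      show False using x y xy4 by auto
    qed
    then have "2 \<le> Im w \<or> Im w \<le> -2 \<or> 3 \<le> Re w \<or> Re w \<le> -2" unfolding xy
      by auto
    moreover have g3: "3 \<le> (cmod w)\<^sup>2 - 1" using m w by simp
    note bounds = offset_disc_bounds[OF g3, folded gw(2)]
    note r = refines_mult_unit[OF u _ mw, where a' = 1, simplified, unfolded gw(1)]
    have g9: "4 < g" if "3 \<le> Re w"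
      using power_mono[of 3 "Re w" 2] that add_increasing2[of "(Im w)\<^sup>2" 9 "(Re w)\<^sup>2"]
      unfolding gw(2) cmod_power2 by simp
    ultimately consider "2 \<le> Im w" | "Im w \<le> -2" | "3 \<le> Re w" | "Re w \<le> -2" by blast
    then show ?thesis
    proof cases
      case 1
      have "cmod (of_real 2 * (of_real g - cnj w) - of_real g * (2 + \<i>)) = cmod (- (2 * cnj w + \<i> * of_real g))"
        by (simp add: algebra_simps)
      also have "\<dots> \<le> g - 2" unfolding norm_minus_cancel by (rule bounds(1)) fact
      finally have "refines a (1, m) (2, a * (2 + \<i>))" by (intro r) (use g3 gw in auto)
      then show ?thesis using \<open>(cmod a)\<^sup>2 = 1\<close>
        by (intro bexI) (auto simp: tail_discs_def)
    next
      case 2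
      have "cmod (of_real 2 * (of_real g - cnj w) - of_real g * (2 - \<i>)) = cmod (- (2 * cnj w - \<i> * of_real g))"
        by (simp add: algebra_simps)
      also have "\<dots> \<le> g - 2" unfolding norm_minus_cancel by (rule bounds(2)) fact
      finally have "refines a (1, m) (2, a * (2 - \<i>))" by (intro r) (use g3 gw in auto)
      then show ?thesis using \<open>(cmod a)\<^sup>2 = 1\<close>
        by (intro bexI) (auto simp: tail_discs_def)
    next
      case 3
      have "cmod (of_real 4 * (of_real g - cnj w) - of_real g * 3) = cmod (of_real g - 4 * cnj w)"
        by (simp add: algebra_simps)
      also have "\<dots> \<le> g - 4" by (rule bounds(3)) fact
      finally have "refines a (1, m) (4, a * 3)" by (intro r) (use g9[OF 3] gw(1) in auto)
      then show ?thesis using \<open>(cmod a)\<^sup>2 = 1\<close>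
        by (intro bexI) (auto simp: tail_discs_def mult.commute)
    next
      case 4
      have "cmod (of_real 1 * (of_real g - cnj w) - of_real g * 2) = cmod (- (cnj w + of_real g))"
        by (simp add: algebra_simps)
      also have "\<dots> \<le> g - 1" unfolding norm_minus_cancel by (rule bounds(4)) fact
      finally have "refines a (1, m) (1, a * 2)" by (intro r) (use g3 gw in auto)
      moreover have "a \<in> offsets t a"
        using \<open>(cmod a)\<^sup>2 = 1\<close> a
          by (simp add: offsets_def norm_mult power_mult_distrib mult_2[symmetric])
      then have "(1, a + a) \<in> tail_discs t a" by (rule offset_in_tail_discs)
      then have "(1, a * 2) \<in> tail_discs t a" by (simp add: mult_2_right)
      ultimately show ?thesis by blast
    qed
  next
    case 2
    then obtain u where u: "u \<in> gaussian_units" "a = u * (1 + \<i>)" using gaussian_norm_2 a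
      by blast
    note u' = gaussian_unitsD[OF u(1)]
    define w where "w = u * m"
    have "cnj u * w = (u * cnj u) * m" by (simp only: w_def mult_ac)
    then have mw: "m = cnj u * w" using u'(7) by simp
    have w: "(cmod w)\<^sup>2 = (cmod m)\<^sup>2" using u' by (simp add: w_def norm_mult)
    have gw: "disc_gap 1 w = g" "g = (cmod w)\<^sup>2 - 1" by (auto simp: disc_gap_def g_eq w)
    have "w \<in> gaussian_ints" using u' m by (simp add: w_def gaussian_ints_closed)
    then obtain x y :: int where xy: "w = Complex (of_int x) (of_int y)" by (rule gaussian_intsE)
    have xy4: "4 \<le> x\<^sup>2 + y\<^sup>2" using m(2) four_le_cmod_power2_of_int_iff
      by (simp add: w[symmetric] xy)
    have "y \<ge> 2 \<or> y \<le> -2 \<or> x \<ge> 2 \<or> x \<le> -2"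
    proof (rule ccontr)
      assume *: "\<not> ?thesis"
      then have "y \<in> {-1, 0, 1}" "x \<in> {-1, 0, 1}" by auto
      then show False using xy4 by auto
    qed
    then have "2 \<le> Im w \<or> Im w \<le> -2 \<or> 2 \<le> Re w \<or> Re w \<le> -2" unfolding xy
      by auto
    moreover have g3: "3 \<le> (cmod w)\<^sup>2 - 1" using m w by simp
    note bounds = offset_disc_bounds[OF g3, folded gw(2)]
    note r = refines_mult_unit[OF u mw, unfolded gw(1)]
    have off: "u \<in> offsets t a" "u * \<i> \<in> offsets t a"
    proof -
      have "a + u = u * (2 + \<i>)" "a + u * \<i> = u * (1 + 2 * \<i>)"
        by (auto simp: u algebra_simps)
      moreover have "\<i> \<in> gaussian_ints" by (simp add: gaussian_ints_def)
      moreover have "(cmod (2 + \<i>))\<^sup>2 = 5" "(cmod (1 + 2 * \<i>))\<^sup>2 = 5"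
        by (auto simp: cmod_power2)
      ultimately show "u \<in> offsets t a" "u * \<i> \<in> offsets t a"
        using u' by (auto simp: offsets_def norm_mult power_mult_distrib gaussian_ints_closed)
    qed
    ultimately consider "2 \<le> Im w" | "Im w \<le> -2" | "2 \<le> Re w" | "Re w \<le> -2" by blast
    then show ?thesis
    proof cases
      case 1
      have "cmod (of_real 1 * (of_real g * (1 + \<i>) - cnj w) - of_real g * (1 + 2 * \<i>)) = cmod (- (cnj w + \<i> * of_real g))"
        by (simp add: algebra_simps)
      also have "\<dots> \<le> g - 1" unfolding norm_minus_cancel by (rule bounds(5)) fact
      finally have "refines a (1, m) (1, u * (1 + 2 * \<i>))" by (intro r) (use g3 gw in auto)
      moreover have "a + u * \<i> = u * (1 + 2 * \<i>)" by (simp add: u algebra_simps)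
      ultimately show ?thesis using offset_in_tail_discs[OF off(2)] by metis
    next
      case 2
      have "cmod (of_real 2 * (of_real g * (1 + \<i>) - cnj w) - of_real g * (2 + \<i>)) = cmod (- (2 * cnj w - \<i> * of_real g))"
        by (simp add: algebra_simps)
      also have "\<dots> \<le> g - 2" unfolding norm_minus_cancel by (rule bounds(2)) fact
      finally have "refines a (1, m) (2, u * (2 + \<i>))" by (intro r) (use g3 gw in auto)
      moreover have "u * (2 + \<i>) = a * (3 - \<i>) / 2"
        by (simp add: u complex_eq_iff algebra_simps)
      ultimately show ?thesis using \<open>(cmod a)\<^sup>2 = 2\<close>
        by (intro bexI) (auto simp: tail_discs_def)
    next
      case 3
      have "cmod (of_real 2 * (of_real g * (1 + \<i>) - cnj w) - of_real g * (1 + 2 * \<i>)) = cmod (- (2 * cnj w - of_real g))"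
        by (simp add: algebra_simps)
      also have "\<dots> \<le> g - 2" unfolding norm_minus_cancel by (rule bounds(6)) fact
      finally have "refines a (1, m) (2, u * (1 + 2 * \<i>))" by (intro r) (use g3 gw in auto)
      moreover have "u * (1 + 2 * \<i>) = a * (3 + \<i>) / 2"
        by (simp add: u complex_eq_iff algebra_simps)
      ultimately show ?thesis using \<open>(cmod a)\<^sup>2 = 2\<close>
        by (intro bexI) (auto simp: tail_discs_def)
    next
      case 4
      have "cmod (of_real 1 * (of_real g * (1 + \<i>) - cnj w) - of_real g * (2 + \<i>)) = cmod (- (cnj w + of_real g))"
        by (simp add: algebra_simps)
      also have "\<dots> \<le> g - 1" unfolding norm_minus_cancel by (rule bounds(4)) fact
      finally have "refines a (1, m) (1, u * (2 + \<i>))" by (intro r) (use g3 gw in auto)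
      moreover have "a + u = u * (2 + \<i>)" by (simp add: u algebra_simps)
      ultimately show ?thesis using offset_in_tail_discs[OF off(1)] by metis
    qed
  next
    case 3
    have "0 \<in> offsets t a" using 3 by (auto simp: offsets_def gaussian_ints_def)
    then have "(1, a) \<in> tail_discs t a" using offset_in_tail_discs by fastforce
    moreover have "refines a (1, m) (1, a)"
    proof -
      have "2\<^sup>2 \<le> (cmod m)\<^sup>2" using m by simp
      then have "2 \<le> cmod m" by (rule power2_le_imp_le) simp
      then have "2 * cmod m \<le> (cmod m)\<^sup>2" by (simp add: power2_eq_square mult_right_mono)
      then have "cmod m \<le> g - 1" using \<open>2 \<le> cmod m\<close> by (simp add: g_eq)
      moreover have "cmod ((of_real g * a - cnj m) - of_real g * a) = cmod m" by simp
      ultimately show ?thesis using \<open>2 \<le> cmod m\<close>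
        by (simp add: refines_def g_def[symmetric])
    qed
    ultimately show ?thesis by blast
  qed
  then show ?thesis by (simp add: m_def)
qed

text \<open>The extra discs have gap 2, so their images have radius 1/2 and touch the unit disc
  around a - cnj b from inside. This is where \<open>admissible\<close> needs a - cnj b to be an
  allowed centre for the letter a.\<close>

lemma refines_tail_discs:
  assumes a: "a \<in> gaussian_ints" "a \<noteq> 0" and b: "b \<in> gaussian_ints"
    and adm: "admissible t a b" and D: "D \<in> tail_discs t b"
  shows "\<exists>E\<in>tail_discs t a. refines a D E"
  using D
proof (cases rule: tail_discs_cases)
  case (offset d)
  then show ?thesis using refines_offset[OF a b adm] by auto
next
  case unit
  obtain k \<beta> where kb: "D = (k, \<beta>)" by (cases D)
  have g: "disc_gap k \<beta> = 2" using disc_gap_unit unit kb by metis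
  have b1: "cmod b = 1" using unit gaussian_norm_1 b gaussian_unitsD by blast
  have "- cnj b \<in> offsets t a"
    using unit b adm by (auto simp: offsets_def admissible_def gaussian_ints_def)
  then have "(1, a - cnj b) \<in> tail_discs t a" using offset_in_tail_discs by fastforce
  moreover have "cmod (2 * a - cnj \<beta> - 2 * (a - cnj b)) = cmod (2 * b - \<beta>)"
    by (subst complex_mod_cnj[symmetric]) (simp add: algebra_simps norm_minus_commute)
  moreover have "cmod (2 * b - \<beta>) = 1"
  proof -
    have "2 * b - 3 * b = - b" "2 * b - b * (2 + \<i>) = - (b * \<i>)" "2 * b - b * (2 - \<i>) = b * \<i>"
      by (auto simp: algebra_simps)
    then show ?thesis using unit b1 kb by (auto simp: norm_mult)
  qed
  ultimately show ?thesis by (intro bexI[of _ "(1, a - cnj b)"]) (auto simp: refines_def kb g)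
next
  case norm_2
  obtain k \<beta> where kb: "D = (k, \<beta>)" by (cases D)
  have g: "disc_gap k \<beta> = 2" using disc_gap_norm_2 norm_2 kb by metis
  obtain u where u: "u \<in> gaussian_units" "b = u * (1 + \<i>)" using gaussian_norm_2 b norm_2
    by blast
  note u' = gaussian_unitsD[OF u(1)]
  have \<beta>: "\<beta> = u * (1 + 2 * \<i>) \<or> \<beta> = u * (2 + \<i>)"
    using norm_2 kb by (auto simp: u complex_eq_iff algebra_simps)
  have eq: "cmod (2 * a - cnj \<beta> - 2 * (a - cnj v)) = cmod (2 * v - \<beta>)" for v
    by (subst complex_mod_cnj[symmetric]) (simp add: algebra_simps norm_minus_commute)
  have refines: "refines a D (1, a - cnj v)" if "cmod (2 * v - \<beta>) \<le> 1" for v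
    using that eq[of v] by (simp add: refines_def kb g)
  show ?thesis
  proof (cases "(cmod a)\<^sup>2 \<le> 5")
    case True
    have "- cnj b \<in> offsets t a"
      using norm_2 b adm True by (auto simp: offsets_def admissible_def gaussian_ints_def)
    then have "(1, a - cnj b) \<in> tail_discs t a" using offset_in_tail_discs by fastforce
    moreover have "cmod (2 * b - \<beta>) = 1"
    proof -
      have "2 * b - u * (1 + 2 * \<i>) = u" "2 * b - u * (2 + \<i>) = u * \<i>"
        by (auto simp: u algebra_simps)
      then show ?thesis using \<beta> u' by (auto simp: norm_mult)
    qed
    ultimately show ?thesis using refines[of b] by fastforce
  next
    case False
    \<comment> \<open>For |a|^2 > 5 no offset of norm 2 is available. A unit v at distance 1/2 from
      the centre \<beta>/2 takes the place of b, and the size of a keeps a - cnj v far enough from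
      0.\<close>
    obtain v where v: "v \<in> gaussian_units" "cmod (2 * v - \<beta>) \<le> 1"
    proof -
      have "\<i> * u \<in> gaussian_units" using u(1) by (auto simp: gaussian_units_def)
      moreover have "2 * (\<i> * u) - u * (1 + 2 * \<i>) = - u" "2 * u - u * (2 + \<i>) = - (u * \<i>)"
        by (auto simp: algebra_simps)
      ultimately show thesis using \<beta> that[of u] that[of "\<i> * u"] u u'
        by (auto simp: norm_mult)
    qed
    have "4 \<le> (cmod (a - cnj v))\<^sup>2"
    proof -
      note v' = gaussian_unitsD[OF v(1)]
      obtain x y :: int where e: "a - cnj v = Complex (of_int x) (of_int y)"
        using gaussian_intsE[of "a - cnj v"] a v' gaussian_ints_closed by metis
      show ?thesis
      proof (rule ccontr)
        assume *: "\<not> ?thesis"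
        then have "x\<^sup>2 + y\<^sup>2 \<le> 3" unfolding e four_le_cmod_power2_of_int_iff by simp
        then have "x \<in> {-1, 0, 1}" "y \<in> {-1, 0, 1}" using int_sum_squares_le_3[of x y]
          by auto
        moreover have "a = Complex (of_int x) (of_int y) + cnj v" using e
          by (simp add: algebra_simps)
        ultimately have "(cmod a)\<^sup>2 \<le> 5" using v(1)
          by (auto simp: gaussian_units_def cmod_power2 Complex_eq)
        then show False using False by simp
      qed
    qed
    then have "- cnj v \<in> offsets t a"
      using gaussian_unitsD[OF v(1)] by (auto simp: offsets_def gaussian_ints_def)
    then have "(1, a - cnj v) \<in> tail_discs t a" using offset_in_tail_discs by fastforce
    then show ?thesis using refines[OF v(2)] by blast
  qed
qed

lemma admissible_imp_converges:
  assumes "b \<in> gaussian_cfs" "\<And>n. b n \<noteq> 0" "\<And>n. admissible t (b n) (b (Suc n))"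
  shows "(\<forall>n. cf_denom b (Suc n) \<noteq> 0) \<and> convergent (\<lambda>n. cf_num b n / cf_denom b n)"
proof (rule nested_discs_imp_converges)
  have b: "b n \<in> gaussian_ints" for n using assms(1) by (auto simp: gaussian_cfs_def)
  fix n
  show "tail_discs t (b n) \<noteq> {}" using b assms(2) by (rule tail_discs_nonempty)
  show "integral_disc D" if "D \<in> tail_discs t (b n)" for D using b that
    by (rule integral_disc_tail_discs)
  show "\<exists>E\<in>tail_discs t (b n). refines (b n) D E" if "D \<in> tail_discs t (b (Suc n))"
    for D
    using refines_tail_discs[OF b assms(2) b assms(3) that] .
  show "\<exists>(l, \<delta>)\<in>tail_discs t (b n). b n \<in> disc l \<delta> \<and> disc k \<beta> \<inter> disc l \<delta> \<noteq> {}"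
    if "(k, \<beta>) \<in> tail_discs t (b n)" for k \<beta>
    using tail_discs_centre[OF b that] .
qed (use assms in auto)

section \<open>Convergence on the Riemann sphere\<close>

lemma limitin_riemann_sphere_Some:
  assumes f: "f \<longlonglongrightarrow> l" and ev: "eventually (\<lambda>n. F n = Some (f n)) sequentially"
  shows "limitin riemann_sphere F (Some l) sequentially"
  unfolding limitin_def
proof (intro conjI allI impI; (elim conjE)?)
  fix U assume "openin riemann_sphere U" "Some l \<in> U"
  then obtain V where V: "open V" "l \<in> V" "Some ` V \<subseteq> U"
  proof -
    from \<open>openin riemann_sphere U\<close> consider (finite) V where "open V" "U = Some ` V"
      | (infinite) C where "closed C" "U = insert None (Some ` (UNIV - C))"
      unfolding openin_Alexandroff_compactification by auto
    then show thesis
    proof cases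
      case finite
      then show thesis using that[of V] \<open>Some l \<in> U\<close> by auto
    next
      case infinite
      then show thesis using that[of "UNIV - C"] \<open>Some l \<in> U\<close> by auto
    qed
  qed
  then have "eventually (\<lambda>n. f n \<in> V) sequentially" using f
    by (simp add: topological_tendstoD)
  then show "eventually (\<lambda>n. F n \<in> U) sequentially"
    using ev by eventually_elim (use V in auto)
qed simp

lemma limitin_riemann_sphere_None:
  assumes "\<And>R. eventually (\<lambda>n. F n = None \<or> (\<exists>z. F n = Some z \<and> R < cmod z)) sequentially"
  shows "limitin riemann_sphere F None sequentially"
  unfolding limitin_def
proof (intro conjI allI impI; (elim conjE)?)
  fix U assume "openin riemann_sphere U" "None \<in> U"
  then obtain C where C: "compact C" "U = insert None (Some ` (UNIV - C))"
    unfolding openin_Alexandroff_compactification by auto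
  obtain R where R: "\<And>z. z \<in> C \<Longrightarrow> cmod z \<le> R"
    using compact_imp_bounded[OF C(1)] by (auto simp: bounded_iff)
  show "eventually (\<lambda>n. F n \<in> U) sequentially"
    using assms[of R] by eventually_elim (use C R in fastforce)
qed simp

lemma linear_recurrence_unique:
  fixes f g :: "nat \<Rightarrow> complex"
  assumes "f 0 = g 0" "f (Suc 0) = g (Suc 0)"
    and f: "\<And>k. f (Suc (Suc k)) = c k * f (Suc k) - f k"
    and g: "\<And>k. g (Suc (Suc k)) = c k * g (Suc k) - g k"
  shows "f k = g k"
proof -
  have "f k = g k \<and> f (Suc k) = g (Suc k)"
  proof (induction k)
    case (Suc k)
    then show ?case using f[of k] g[of k] by simp
  qed (use assms in simp)
  then show ?thesis by blast
qed

lemma cf_num_denom_tail: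
  "cf_num b (Suc n + k) = cf_num b (Suc n) * cf_num (\<lambda>j. b (Suc n + j)) k
     - cf_num b n * cf_denom (\<lambda>j. b (Suc n + j)) k"
  "cf_denom b (Suc n + k) = cf_denom b (Suc n) * cf_num (\<lambda>j. b (Suc n + j)) k
     - cf_denom b n * cf_denom (\<lambda>j. b (Suc n + j)) k"
  by (rule linear_recurrence_unique[where c = "\<lambda>k. b (Suc n + Suc k)"]; simp add: algebra_simps)+

text \<open>The convergents are the images of those of the tail under a Moebius map of determinant
  -1. If the limit L of the tail is its pole, the determinant keeps the numerator away from 0 there,
  and the convergents tend to infinity.\<close>

lemma cf_converges_if_tail_converges:
  fixes b :: "nat \<Rightarrow> complex" and n :: nat
  defines "c \<equiv> \<lambda>j. b (Suc n + j)"
  assumes nz: "\<And>k. cf_denom c (Suc k) \<noteq> 0" and conv: "convergent (\<lambda>k. cf_num c k / cf_denom c k)"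
  shows "cf_converges b"
proof -
  define x where "x k = cf_num c k / cf_denom c k" for k
  have "convergent x" using conv by (simp add: x_def[abs_def])
  then obtain L where L: "x \<longlonglongrightarrow> L" by (auto simp: convergent_def)
  define A A' q p where "A = cf_num b (Suc n)" and "A' = cf_num b n"
    and "q = cf_denom b (Suc n)" and "p = cf_denom b n"
  have det: "A * p - A' * q = -1" unfolding A_def A'_def p_def q_def by (rule cf_det)
  \<comment> \<open>The index \<open>Suc k\<close> skips the convergent of the tail with index 0,
    whose denominator vanishes.\<close>
  have num: "cf_num b (Suc n + Suc k) = cf_denom c (Suc k) * (A * x (Suc k) - A')" for k
    using nz unfolding cf_num_denom_tail x_def A_def A'_def c_def by (simp add: algebra_simps)
  have denom: "cf_denom b (Suc n + Suc k) = cf_denom c (Suc k) * (q * x (Suc k) - p)" for k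
    using nz unfolding cf_num_denom_tail x_def q_def p_def c_def by (simp add: algebra_simps)
  define y where "y k = x (Suc k)" for k
  have y: "y \<longlonglongrightarrow> L" unfolding y_def using L by (rule LIMSEQ_Suc)
  have conv_y: "cf_convergent b (Suc n + Suc k) =
      (if q * y k - p = 0 then None else Some ((A * y k - A') / (q * y k - p)))" for k
    unfolding cf_convergent_def num denom y_def using nz by simp
  define F where "F k = cf_convergent b (k + Suc (Suc n))" for k
  have F: "F k = (if q * y k - p = 0 then None else Some ((A * y k - A') / (q * y k - p)))" for k
    using conv_y[of k] by (simp add: F_def add.commute)
  have qy: "(\<lambda>k. q * y k - p) \<longlonglongrightarrow> q * L - p" and Ay: "(\<lambda>k. A * y k - A') \<longlonglongrightarrow> A * L - A'"
    using y by (auto intro!: tendsto_intros)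
  have "\<exists>l. limitin riemann_sphere F l sequentially"
  proof (cases "q * L - p = 0")
    case False
    then have "eventually (\<lambda>k. q * y k - p \<noteq> 0) sequentially"
      using tendsto_imp_eventually_ne[OF qy] by blast
    then have "eventually (\<lambda>k. F k = Some ((A * y k - A') / (q * y k - p))) sequentially"
      by eventually_elim (simp add: F)
    moreover have "(\<lambda>k. (A * y k - A') / (q * y k - p)) \<longlonglongrightarrow> (A * L - A') / (q * L - p)"
      using qy Ay False by (intro tendsto_divide)
    ultimately show ?thesis using limitin_riemann_sphere_Some by blast
  next
    case True
    have "A * L - A' \<noteq> 0"
    proof
      assume "A * L - A' = 0"
      then have "A' = A * L" "p = q * L" using True by simp_all
      then have "A * p - A' * q = 0" by simp
      then show False using det by simp
    qed
    define e where "e = cmod (A * L - A') / 2"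
    have e: "e > 0" "e < cmod (A * L - A')" using \<open>A * L - A' \<noteq> 0\<close>
      by (auto simp: e_def)
    have "eventually (\<lambda>n. F n = None \<or> (\<exists>z. F n = Some z \<and> R < cmod z)) sequentially" for R
    proof -
      define R' where "R' = max R 0 + 1"
      have R': "R' > 0" "R < R'" by (auto simp: R'_def)
      have "(\<lambda>k. cmod (q * y k - p)) \<longlonglongrightarrow> 0"
        using tendsto_norm[OF qy] True by simp
      then have "eventually (\<lambda>k. cmod (q * y k - p) < e / R') sequentially"
        using e R' by (intro order_tendstoD) auto
      moreover have "eventually (\<lambda>k. e < cmod (A * y k - A')) sequentially"
        using order_tendstoD(1)[OF tendsto_norm[OF Ay]] e by blast
      ultimately show ?thesis
      proof eventually_elim
        case (elim k)
        show ?case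
        proof (cases "q * y k - p = 0")
          case False
          have "R' * cmod (q * y k - p) < e" using elim(1) R'
            by (simp add: pos_less_divide_eq mult.commute)
          then have "R' * cmod (q * y k - p) < cmod (A * y k - A')" using elim(2) by linarith
          then have "R' < cmod ((A * y k - A') / (q * y k - p))"
            using False by (simp add: norm_divide pos_less_divide_eq)
          then show ?thesis using False R' by (simp add: F)
        qed (simp add: F)
      qed
    qed
    then show ?thesis using limitin_riemann_sphere_None by blast
  qed
  then show ?thesis
    unfolding cf_converges_def F_def
    using limitin_sequentially_offset_rev[of riemann_sphere "cf_convergent b" "Suc (Suc n)"]
      by blast
qed

text \<open>The four values say that the matrix of one period is s times the identity. Convergents
  then repeat with the period, so infinity and \<open>b 0\<close> both occur infinitely
  often.\<close>

lemma periodic_cf_diverges: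
  assumes per: "\<And>k. b (k + Suc m) = b k"
    and s: "cf_num b (Suc m) = s" "cf_num b (Suc (Suc m)) = s * b 0"
      "cf_denom b (Suc m) = 0" "cf_denom b (Suc (Suc m)) = s" "s \<noteq> 0"
  shows "\<not> cf_converges b"
proof
  assume "cf_converges b"
  then obtain l where l: "limitin riemann_sphere (cf_convergent b) l sequentially"
    by (auto simp: cf_converges_def)
  have cf_num: "cf_num b (k + Suc m) = s * cf_num b k" for k
  proof (rule linear_recurrence_unique[where c = "\<lambda>k. b (Suc k)"])
    show "cf_num b (0 + Suc m) = s * cf_num b 0" using s(1) by simp
    show "cf_num b (Suc 0 + Suc m) = s * cf_num b (Suc 0)" using s(2) by simp
    fix k
    show "cf_num b (Suc (Suc k) + Suc m) = b (Suc k) * cf_num b (Suc k + Suc m) - cf_num b (k + Suc m)"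
      using per[of "Suc k"] by simp
    show "s * cf_num b (Suc (Suc k)) = b (Suc k) * (s * cf_num b (Suc k)) - s * cf_num b k"
      by (simp add: algebra_simps)
  qed
  have cf_denom: "cf_denom b (k + Suc m) = s * cf_denom b k" for k
  proof (rule linear_recurrence_unique[where c = "\<lambda>k. b (Suc k)"])
    show "cf_denom b (0 + Suc m) = s * cf_denom b 0" using s(3) by simp
    show "cf_denom b (Suc 0 + Suc m) = s * cf_denom b (Suc 0)" using s(4) by simp
    fix k
    show "cf_denom b (Suc (Suc k) + Suc m) = b (Suc k) * cf_denom b (Suc k + Suc m) - cf_denom b (k + Suc m)"
      using per[of "Suc k"] by simp
    show "s * cf_denom b (Suc (Suc k)) = b (Suc k) * (s * cf_denom b (Suc k)) - s * cf_denom b k"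
      by (simp add: algebra_simps)
  qed
  have per_conv: "cf_convergent b (k + Suc m) = cf_convergent b k" for k
    unfolding cf_convergent_def cf_num cf_denom using \<open>s \<noteq> 0\<close> by simp
  have per_conv': "cf_convergent b (j * Suc m) = None \<and> cf_convergent b (Suc (j * Suc m)) = Some (b 0)" for j
  proof (induction j)
    case (Suc j)
    have "cf_convergent b (Suc j * Suc m) = cf_convergent b (j * Suc m)"
      "cf_convergent b (Suc (Suc j * Suc m)) = cf_convergent b (Suc (j * Suc m))"
      using per_conv[of "j * Suc m"] per_conv[of "Suc (j * Suc m)"] by (simp_all add: add_ac)
    then show ?case using Suc by simp
  qed (simp add: cf_convergent_def)
  have "\<exists>U. openin riemann_sphere U \<and> l \<in> U \<and> (None \<notin> U \<or> Some (b 0) \<notin> U)"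
  proof (cases l)
    case None
    have "openin riemann_sphere (insert None (Some ` (UNIV - {b 0})))"
      unfolding openin_Alexandroff_compactification by (rule disjI2, rule exI[of _ "{b 0}"]) simp
    then show ?thesis using None by (intro exI[of _ "insert None (Some ` (UNIV - {b 0}))"]) auto
  next
    case (Some z)
    then show ?thesis by (intro exI[of _ "range Some"]) auto
  qed
  then obtain U N
    where U: "None \<notin> U \<or> Some (b 0) \<notin> U" "\<And>n. N \<le> n \<Longrightarrow> cf_convergent b n \<in> U"
    using l unfolding limitin_sequentially by metis
  have "N \<le> N * Suc m" by simp
  then show False using U per_conv'[of N] by (metis le_SucI)
qed

section \<open>Symmetric sets of two-letter words\<close>

text \<open>An induction principle shared by reversal, the invariant \<open>U_shape\<close> and the
  property of being met by an exclusion set. The word \<open>[0]\<close> enters through the rule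
  \<open>zero\<close> and needs its own disjunct.\<close>

lemma sym_closure_pairs:
  assumes "w \<in> sym_closure X"
    and "\<And>w. w \<in> X \<Longrightarrow> \<exists>a b. w = [a, b] \<and> Q a b"
    and "\<And>a b. Q a b \<Longrightarrow> Q (cnj a) (cnj b)"
    and "\<And>u a b. u \<in> gaussian_units \<Longrightarrow> Q a b \<Longrightarrow> Q (u * a) (inverse u * b)"
  shows "w = [0] \<or> (\<exists>a b. w = [a, b] \<and> Q a b)"
  using assms(1) by (induction rule: sym_closure.induct) (use assms(2-4) in fastforce)+

lemma sym_closure_idem: "sym_closure (sym_closure X) = sym_closure X"
proof
  show "sym_closure (sym_closure X) \<subseteq> sym_closure X"
  proof
    fix w assume "w \<in> sym_closure (sym_closure X)"
    then show "w \<in> sym_closure X" by induction (auto intro: sym_closure.intros)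
  qed
qed (auto intro: sym_closure.base)

lemma rev_in_sym_closure:
  assumes "w \<in> sym_closure X" and X: "\<And>w. w \<in> X \<Longrightarrow> length w = 2 \<and> rev w \<in> X"
  shows "rev w \<in> sym_closure X"
proof -
  have "w = [0] \<or> (\<exists>a b. w = [a, b] \<and> [b, a] \<in> sym_closure X)"
  proof (rule sym_closure_pairs[OF assms(1)])
    fix w assume "w \<in> X"
    then obtain a b where "w = [a, b]" using X
      by (metis length_Suc_conv length_0_conv numeral_2_eq_2)
    then show "\<exists>a b. w = [a, b] \<and> [b, a] \<in> sym_closure X"
      using X[OF \<open>w \<in> X\<close>] by (auto intro: sym_closure.base)
  next
    fix a b assume "[b, a] \<in> sym_closure X"
    then show "[cnj b, cnj a] \<in> sym_closure X" using sym_closure.conj by fastforce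
  next
    fix u a b assume u: "u \<in> gaussian_units" and "[b, a] \<in> sym_closure X"
    \<comment> \<open>Swapping the letters of a pair twisted by u gives the swapped pair twisted by
      \<open>inverse u\<close>.\<close>
    then have "twist (inverse u) [b, a] \<in> sym_closure X" using gaussian_unitsD(4)
      by (intro sym_closure.twist)
    then show "[inverse u * b, u * a] \<in> sym_closure X" by simp
  qed
  then show ?thesis using sym_closure.zero by auto
qed

lemma mset_eq_pair_iff: "mset w = {#a, b#} \<longleftrightarrow> w = [a, b] \<or> w = [b, a]"
proof
  assume *: "mset w = {#a, b#}"
  then have "length w = 2" by (metis size_mset size_add_mset size_empty numeral_2_eq_2)
  then obtain c d where "w = [c, d]" by (metis length_Suc_conv length_0_conv numeral_2_eq_2)
  then show "w = [a, b] \<or> w = [b, a]" using * by (auto simp: add_eq_conv_ex)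
qed auto

definition U_words :: "bool \<Rightarrow> complex list set" where
  "U_words t = (if t then U2 else U1)"

definition common_pairs :: "(complex \<times> complex) set" where
  "common_pairs = {(1, 1), (1, 2), (1, 3), (1, \<i>), (1, 1 + \<i>), (1, 2 + \<i>), (1, 3 + \<i>), (1, 2 + 2 * \<i>),
     (1 + \<i>, 1 - \<i>), (1 + \<i>, 2), (1 + \<i>, 2 - \<i>)}"

definition special_pair :: "bool \<Rightarrow> complex \<times> complex" where
  "special_pair t = (if t then (1 + \<i>, 2 + \<i>) else (1, 1 + 2 * \<i>))"

lemma U_words_eq:
  "U_words t = (\<Union>(a, b)\<in>insert (special_pair t) common_pairs. {[a, b], [b, a]})"
  unfolding U_words_def U1_def U2_def arrangements_def special_pair_def common_pairs_def
  by (cases t) (auto simp: mset_eq_pair_iff)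

definition U_closure :: "bool \<Rightarrow> complex list set" where
  "U_closure t = sym_closure (U_words t)"

lemma pair_in_U_closure:
  assumes "(a, b) \<in> insert (special_pair t) common_pairs"
  shows "[a, b] \<in> U_closure t" "[b, a] \<in> U_closure t"
  unfolding U_closure_def U_words_eq by (rule sym_closure.base, rule UN_I[OF assms], simp)+

lemma U_closure_rev: "w \<in> U_closure t \<Longrightarrow> rev w \<in> U_closure t"
  unfolding U_closure_def by (erule rev_in_sym_closure) (auto simp: U_words_eq)

text \<open>An invariant of the closure; the last two clauses exclude the special pair of the other set.\<close>

definition U_shape :: "bool \<Rightarrow> complex \<Rightarrow> complex \<Rightarrow> bool" where
  "U_shape t a b \<longleftrightarrow> a \<in> gaussian_ints \<and> b \<in> gaussian_ints \<and> a \<noteq> 0 \<and> b \<noteq> 0 \<and>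
    (cmod a)\<^sup>2 \<le> 10 \<and> (cmod b)\<^sup>2 \<le> 10 \<and>
    (t \<and> (cmod a)\<^sup>2 = 1 \<and> (cmod b)\<^sup>2 = 5 \<longrightarrow> (Re (a * b))\<^sup>2 = 4) \<and>
    (\<not> t \<and> (cmod a)\<^sup>2 = 2 \<and> (cmod b)\<^sup>2 = 5 \<longrightarrow> (Re (a * b))\<^sup>2 = 9)"

lemma U_shapeD:
  assumes "U_shape t a b"
  shows "a \<in> gaussian_ints" "b \<in> gaussian_ints" "a \<noteq> 0" "b \<noteq> 0" "(cmod a)\<^sup>2 \<le> 10" "(cmod b)\<^sup>2 \<le> 10"
  using assms by (simp_all add: U_shape_def)

text \<open>Twisting fixes the product of the two letters and conjugation fixes its real part. The
  squares 4 and 9 come from 1 (2 + i) = 2 + i and (1 + i)(2 - i) = 3 + i, whereas the products 1 +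
  2i and (1 + i)(2 + i) = 1 + 3i of the special pairs have real part 1.\<close>

lemma U_closure_cases:
  assumes "w \<in> U_closure t"
  shows "w = [0] \<or> (\<exists>a b. w = [a, b] \<and> U_shape t a b)"
  using assms unfolding U_closure_def
proof (rule sym_closure_pairs)
  fix w assume "w \<in> U_words t"
  then obtain p
    where p: "p \<in> insert (special_pair t) common_pairs" "w \<in> (case p of (a, b) \<Rightarrow> {[a, b], [b, a]})"
    unfolding U_words_eq by (rule UN_E)
  moreover have "U_shape t a b \<and> U_shape t b a"
    if "(a, b) \<in> insert (special_pair t) common_pairs" for a b
    using that unfolding common_pairs_def special_pair_def
    by (cases t; elim insertE emptyE; clarsimp simp: U_shape_def gaussian_ints_def cmod_power2; simp add: complex_eq_iff)
  ultimately show "\<exists>a b. w = [a, b] \<and> U_shape t a b" by (cases p) auto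
next
  fix u a b assume u: "u \<in> gaussian_units" and *: "U_shape t a b"
  note u' = gaussian_unitsD[OF u]
  have ab: "u * a * (inverse u * b) = a * b" using u' by (simp add: field_simps)
  show "U_shape t (u * a) (inverse u * b)"
    unfolding U_shape_def ab using * u' gaussian_unitsD(1)[OF u'(4)]
    by (auto simp: U_shape_def norm_mult norm_inverse gaussian_ints_closed)
next
  fix a b assume "U_shape t a b"
  then show "U_shape t (cnj a) (cnj b)" by (auto simp: U_shape_def gaussian_ints_def)
qed

lemma special_pair_in_U_closure_iff:
  "[fst (special_pair s), snd (special_pair s)] \<in> U_closure t \<longleftrightarrow> s = t"
proof
  assume "[fst (special_pair s), snd (special_pair s)] \<in> U_closure t"
  then have "U_shape t (fst (special_pair s)) (snd (special_pair s))" using U_closure_cases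
    by fastforce
  then show "s = t" by (cases s; cases t) (auto simp: U_shape_def special_pair_def cmod_power2)
next
  assume "s = t"
  then show "[fst (special_pair s), snd (special_pair s)] \<in> U_closure t"
    by (intro pair_in_U_closure(1)) simp
qed

lemma finite_gaussian_ball: "finite {z \<in> gaussian_ints. (cmod z)\<^sup>2 \<le> 10}"
proof (rule finite_subset)
  show "{z \<in> gaussian_ints. (cmod z)\<^sup>2 \<le> 10} \<subseteq> (\<lambda>(x, y). Complex (of_int x) (of_int y)) ` ({-10..10} \<times> {-10..10})"
  proof
    fix z assume z: "z \<in> {z \<in> gaussian_ints. (cmod z)\<^sup>2 \<le> 10}"
    then obtain x y :: int where xy: "z = Complex (of_int x) (of_int y)" using gaussian_intsE
      by auto
    have "real_of_int (x\<^sup>2 + y\<^sup>2) \<le> real_of_int 10" using z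
      unfolding xy mem_Collect_eq cmod_power2_of_int by simp
    then have "x\<^sup>2 + y\<^sup>2 \<le> 10" by (simp only: of_int_le_iff)
    then have "x\<^sup>2 \<le> 100" "y\<^sup>2 \<le> 100"
      using zero_le_power2[of x] zero_le_power2[of y] by linarith+
    then have "\<bar>x\<bar> \<le> 10" "\<bar>y\<bar> \<le> 10"
      using abs_le_square_iff[of x 10] abs_le_square_iff[of y 10] by auto
    then show "z \<in> (\<lambda>(x, y). Complex (of_int x) (of_int y)) ` ({-10..10} \<times> {-10..10})"
      using xy by (intro image_eqI[of _ _ "(x, y)"]) auto
  qed
qed simp

lemma finite_U_closure: "finite (U_closure t)"
proof (rule finite_subset)
  let ?G = "{z \<in> gaussian_ints. (cmod z)\<^sup>2 \<le> 10}"
  show "U_closure t \<subseteq> insert [0] ((\<lambda>(a, b). [a, b]) ` (?G \<times> ?G))"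
    using U_closure_cases U_shapeD by fastforce
  show "finite (insert [0] ((\<lambda>(a, b). [a, b]) ` (?G \<times> ?G)))"
    using finite_gaussian_ball by blast
qed

lemma word_set_length_U_closure: "word_set_length (U_closure t) = 2"
proof -
  have "[1, 1] \<in> U_closure t" by (rule pair_in_U_closure) (simp add: common_pairs_def)
  then have "enat (length [1, 1 :: complex]) \<le> word_set_length (U_closure t)"
    unfolding word_set_length_def by (rule SUP_upper)
  moreover have "word_set_length (U_closure t) \<le> 2"
    unfolding word_set_length_def
  proof (rule SUP_least)
    fix w assume "w \<in> U_closure t"
    then have "length w \<le> 2" using U_closure_cases[of w t] by auto
    then show "enat (length w) \<le> 2" by (simp add: numeral_eq_enat)
  qed
  ultimately show ?thesis by (simp add: numeral_eq_enat eval_nat_numeral)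
qed

lemma symmetric_U_closure: "symmetric_word_set (U_closure t)"
proof -
  have "w \<in> words" if "w \<in> U_closure t" for w
  proof -
    have "0 \<in> gaussian_ints" by (simp add: gaussian_ints_def)
    then show ?thesis using U_closure_cases[OF that] by (auto simp: words_def dest: U_shapeD(1,2))
  qed
  then show ?thesis unfolding symmetric_word_set_def U_closure_def sym_closure_idem by blast
qed

text \<open>The other words all have two letters, none of them 0, so \<open>[0]\<close> is a
  substring of none.\<close>

lemma without_redundancy_U_closure: "without_redundancy (U_closure t)"
  unfolding without_redundancy_def
proof (intro ballI impI)
  fix x y assume "x \<in> U_closure t" "y \<in> U_closure t" "x \<noteq> y"
  then show "\<not> sublist x y"
    using U_closure_cases[of x t] U_closure_cases[of y t]
      by (auto simp: sublist_Cons_right dest: U_shapeD(3,4))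
qed

section \<open>Pairs outside the closure are admissible\<close>

definition forbidden_products :: "bool \<Rightarrow> complex set" where
  "forbidden_products t = {1, 2, 3, \<i>, -\<i>, 1 + \<i>, 1 - \<i>, 2 + \<i>, 2 - \<i>, 3 + \<i>, 3 - \<i>, 2 + 2 * \<i>, 2 - 2 * \<i>}
     \<union> (if t then {} else {1 + 2 * \<i>, 1 - 2 * \<i>})"

text \<open>Twisting by the inverse of u turns the pair (u, b) into (1, u b), so membership of a
  pair with a unit letter can be read off from the product.\<close>

lemma forbidden_product_in_U_closure:
  assumes "u \<in> gaussian_units" "u * b \<in> forbidden_products t"
  shows "[u, b] \<in> U_closure t" "[b, u] \<in> U_closure t"
proof -
  have "(1, p) \<in> insert (special_pair t) common_pairs \<or> (1, cnj p) \<in> insert (special_pair t) common_pairs"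
    if "p \<in> forbidden_products t" for p
    using that unfolding forbidden_products_def common_pairs_def special_pair_def
    by (cases t; simp; elim disjE; simp)
  then have "[1, u * b] \<in> U_closure t \<or> [1, cnj (u * b)] \<in> U_closure t"
    using assms(2) pair_in_U_closure(1) by blast
  then have "[1, u * b] \<in> U_closure t"
    using sym_closure.conj[of "[1, cnj (u * b)]"] unfolding U_closure_def by auto
  then have "twist u [1, u * b] \<in> U_closure t" unfolding U_closure_def
    by (intro sym_closure.twist assms)
  moreover have "inverse u * (u * b) = b" using gaussian_unitsD(3)[OF assms(1)] by simp
  ultimately show "[u, b] \<in> U_closure t" by simp
  then show "[b, u] \<in> U_closure t" using U_closure_rev by fastforce
qed

text \<open>Twisting by i and then conjugating fixes the second letter 1 + i; on the first letter it
  acts as the reflection in the line through 0 and 1 - i. This halves the list of first letters to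
  be treated.\<close>

lemma reflect_in_U_closure:
  assumes "[x, 1 + \<i>] \<in> U_closure t"
  shows "[- \<i> * cnj x, 1 + \<i>] \<in> U_closure t"
proof -
  have "map cnj (twist \<i> [x, 1 + \<i>]) \<in> U_closure t"
    using assms unfolding U_closure_def
    by (intro sym_closure.conj sym_closure.twist) (auto simp: gaussian_units_def)
  moreover have "map cnj (twist \<i> [x, 1 + \<i>]) = [- \<i> * cnj x, 1 + \<i>]"
    by (simp add: complex_eq_iff)
  ultimately show ?thesis by simp
qed

text \<open>Multiplying by b turns a - cnj b into b a - 1. Apart from 0, every Gaussian integer b a
  whose distance from 1 has square at most 3 is a forbidden product.\<close>

lemma not_in_U_closure_imp_far_from_unit:
  assumes a: "a \<in> gaussian_ints" "a \<noteq> 0" and b: "b \<in> gaussian_ints"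
    and nin: "[a, b] \<notin> U_closure t" and b1: "(cmod b)\<^sup>2 = 1"
  shows "4 \<le> (cmod (a - cnj b))\<^sup>2"
proof (rule ccontr)
  assume *: "\<not> ?thesis"
  have u: "b \<in> gaussian_units" using b b1 by (rule gaussian_norm_1)
  note u' = gaussian_unitsD[OF u]
  have "b * (a - cnj b) = b * a - 1" using u'(7) by (simp add: algebra_simps)
  then have eq: "cmod (a - cnj b) = cmod (b * a - 1)" using u'(2) by (metis norm_mult mult_1)
  have "b * a - 1 \<in> gaussian_ints"
  proof (rule gaussian_ints_closed)
    show "b * a \<in> gaussian_ints" using b a(1) by (rule gaussian_ints_closed)
  qed (simp add: gaussian_ints_def)
  then obtain x y :: int where xy: "b * a - 1 = Complex (of_int x) (of_int y)"
    by (rule gaussian_intsE)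
  have "x\<^sup>2 + y\<^sup>2 \<le> 3" using * unfolding eq xy four_le_cmod_power2_of_int_iff
    by simp
  then have "x \<in> {-1, 0, 1}" "y \<in> {-1, 0, 1}" by (rule int_sum_squares_le_3)+
  moreover have "b * a = Complex (of_int x) (of_int y) + 1" using xy by (simp add: algebra_simps)
  moreover have "b * a \<noteq> 0" using a u' by simp
  ultimately have "b * a \<in> forbidden_products t"
    unfolding forbidden_products_def
    by (elim insertE emptyE; simp add: complex_eq_iff)
  then show False using forbidden_product_in_U_closure(2)[OF u] nin by blast
qed

lemma not_in_U_closure_imp_offset_allowed:
  assumes a: "a \<in> gaussian_ints" and b: "b \<in> gaussian_ints"
    and nin: "[a, b] \<notin> U_closure t" and a1: "(cmod a)\<^sup>2 = 1" and d: "d \<in> offsets t b"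
  shows "a * (b + d) \<notin> {2, 2 + \<i>, 2 - \<i>}"
proof
  assume m: "a * (b + d) \<in> {2, 2 + \<i>, 2 - \<i>}"
  have u: "a \<in> gaussian_units" using a a1 by (rule gaussian_norm_1)
  note u' = gaussian_unitsD[OF u]
  have "a * d \<in> gaussian_ints" using a d by (auto simp: offsets_def gaussian_ints_closed)
  then obtain x y :: int where xy: "a * d = Complex (of_int x) (of_int y)" by (rule gaussian_intsE)
  have ad: "(cmod d)\<^sup>2 = (cmod (a * d))\<^sup>2" and ab: "(cmod b)\<^sup>2 = (cmod (a * b))\<^sup>2"
    and am: "(cmod (b + d))\<^sup>2 = (cmod (a * (b + d)))\<^sup>2" using u'(2)
      by (simp_all add: norm_mult)
  have off: "(cmod (a * d))\<^sup>2 \<le> 1 \<or> (cmod (a * d))\<^sup>2 = 2 \<and> (cmod (a * b))\<^sup>2 \<le> 5 \<and>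
      \<not> (t \<and> (cmod (a * b))\<^sup>2 = 5 \<and> (cmod (a * (b + d)))\<^sup>2 = 5)"
    using d unfolding offsets_def ad[symmetric] ab[symmetric] am[symmetric] by blast
  then have "real_of_int (x\<^sup>2 + y\<^sup>2) \<le> real_of_int 2"
    unfolding xy cmod_power2_of_int by linarith
  then have "x\<^sup>2 + y\<^sup>2 \<le> 3" by (simp only: of_int_le_iff)
  then have xy_cases: "x \<in> {-1, 0, 1}" "y \<in> {-1, 0, 1}" by (rule int_sum_squares_le_3)+
  have b_eq: "a * b = a * (b + d) - Complex (of_int x) (of_int y)" using xy
    by (simp add: algebra_simps)
  \<comment> \<open>Subtracting the allowed offsets from 2, 2 + i and 2 - i gives only forbidden
    products. The bound 5 in \<open>offsets\<close> is essential: 2 + i is 3 + 2i shifted by -1 - i,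
    but {1, 3 + 2i} is not excluded. The exception for \<open>t\<close> likewise removes the step
    from 1 + 2i to 2 + i.\<close>
  have "a * b \<in> forbidden_products t"
    using m off xy_cases unfolding xy forbidden_products_def b_eq
    by (elim insertE emptyE; simp add: complex_eq_iff cmod_power2; (cases t; simp add: complex_eq_iff)?)
  then show False using forbidden_product_in_U_closure(1)[OF u] nin by blast
qed

text \<open>A twist moves b to 1 + i and a to x, so that a - cnj b becomes x - (1 - i). The letters
  x to be ruled out are first letters of words ending in 1 + i, listed up to the reflection that
  fixes 1 + i.\<close>

lemma not_in_U_closure_imp_far_from_norm_2:
  assumes a: "a \<in> gaussian_ints" "a \<noteq> 0" "(cmod a)\<^sup>2 \<le> 5" and b: "b \<in> gaussian_ints"
    and nin: "[a, b] \<notin> U_closure t" and b2: "(cmod b)\<^sup>2 = 2"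
  shows "4 \<le> (cmod (a - cnj b))\<^sup>2" "\<not> (t \<and> (cmod a)\<^sup>2 = 5 \<and> (cmod (a - cnj b))\<^sup>2 = 5)"
proof -
  obtain u where u: "u \<in> gaussian_units" "b = u * (1 + \<i>)" using gaussian_norm_2[OF b b2] .
  note u' = gaussian_unitsD[OF u(1)]
  define x where "x = u * a"
  have xnin: "[x, 1 + \<i>] \<notin> U_closure t"
  proof
    assume "[x, 1 + \<i>] \<in> U_closure t"
    then have "twist (inverse u) [x, 1 + \<i>] \<in> U_closure t"
      unfolding U_closure_def by (intro sym_closure.twist u')
    moreover have "inverse u * x = a" using u'(3) by (simp add: x_def)
    ultimately show False using nin by (simp add: u)
  qed
  have "u * (a - cnj b) = x - (1 - \<i>)" using u'(7) by (simp add: x_def u algebra_simps)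
  then have eq: "cmod (a - cnj b) = cmod (x - (1 - \<i>))" using u'(2) by (metis norm_mult mult_1)
  have x: "x \<noteq> 0" "cmod x = cmod a" using a u' by (auto simp: x_def norm_mult)
  have G: "x - (1 - \<i>) \<in> gaussian_ints"
    using a u' by (auto simp: x_def intro!: gaussian_ints_closed) (auto simp: gaussian_ints_def)
  then obtain s r :: int where sr: "x - (1 - \<i>) = Complex (of_int s) (of_int r)"
    by (rule gaussian_intsE)
  then have x_eq: "x = Complex (of_int (s + 1)) (of_int (r - 1))" by (simp add: complex_eq_iff)
  have base: "[1, 1 + \<i>] \<in> U_closure t" "[1 - \<i>, 1 + \<i>] \<in> U_closure t" "[2, 1 + \<i>] \<in> U_closure t"
    "[2 - \<i>, 1 + \<i>] \<in> U_closure t" "t \<Longrightarrow> [2 + \<i>, 1 + \<i>] \<in> U_closure t"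
    by (rule pair_in_U_closure; simp add: common_pairs_def special_pair_def)+
  then have nin': "x \<notin> {1, 1 - \<i>, 2, 2 - \<i>, - \<i> * cnj 1, - \<i> * cnj 2, - \<i> * cnj (2 - \<i>)}"
    "t \<Longrightarrow> x \<notin> {2 + \<i>, - \<i> * cnj (2 + \<i>)}"
    using xnin reflect_in_U_closure by blast+
  have x_le: "(s + 1)\<^sup>2 + (r - 1)\<^sup>2 \<le> 5"
  proof -
    have "real_of_int ((s + 1)\<^sup>2 + (r - 1)\<^sup>2) \<le> real_of_int 5"
      using a(3) x(2) unfolding x_eq using cmod_power2_of_int[of "s + 1" "r - 1"] by simp
    then show ?thesis by (simp only: of_int_le_iff)
  qed
  show "4 \<le> (cmod (a - cnj b))\<^sup>2"
  proof (rule ccontr)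
    assume *: "\<not> ?thesis"
    then have "s\<^sup>2 + r\<^sup>2 \<le> 3" unfolding eq sr four_le_cmod_power2_of_int_iff by simp
    then have "s \<in> {-1, 0, 1}" "r \<in> {-1, 0, 1}" by (rule int_sum_squares_le_3)+
    then show False using nin'(1) x(1) x_le unfolding x_eq
      by (elim insertE emptyE; simp add: complex_eq_iff)
  qed
  show "\<not> (t \<and> (cmod a)\<^sup>2 = 5 \<and> (cmod (a - cnj b))\<^sup>2 = 5)"
  proof
    assume *: "t \<and> (cmod a)\<^sup>2 = 5 \<and> (cmod (a - cnj b))\<^sup>2 = 5"
    have "real_of_int (s\<^sup>2 + r\<^sup>2) = real_of_int 5" using *
      unfolding eq sr cmod_power2_of_int by simp
    then have 1: "s\<^sup>2 + r\<^sup>2 = 5" by (simp only: of_int_eq_iff)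
    have "real_of_int ((s + 1)\<^sup>2 + (r - 1)\<^sup>2) = real_of_int 5"
      using * x(2) unfolding x_eq using cmod_power2_of_int[of "s + 1" "r - 1"] by simp
    then have 2: "(s + 1)\<^sup>2 + (r - 1)\<^sup>2 = 5" by (simp only: of_int_eq_iff)
    \<comment> \<open>The difference of the two equations says that x is equidistant from 0 and 1 -
      i. The two solutions are 2 + i and its mirror image -1 - 2i.\<close>
    have "s = r - 1" using 1 2 by (simp add: power2_eq_square algebra_simps)
    then have "(r - 2) * (r + 1) = 0" using 1 unfolding \<open>s = r - 1\<close>
      by (simp add: power2_eq_square algebra_simps)
    then have "r = 2 \<or> r = -1" by auto
    then show False using nin'(2) * \<open>s = r - 1\<close> unfolding x_eq
      by (auto simp: complex_eq_iff)
  qed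
qed

lemma not_in_U_closure_imp_admissible:
  assumes "a \<in> gaussian_ints" "a \<noteq> 0" "b \<in> gaussian_ints" "[a, b] \<notin> U_closure t"
  shows "admissible t a b"
  unfolding admissible_def
  using not_in_U_closure_imp_far_from_unit[OF assms] not_in_U_closure_imp_offset_allowed[OF assms(1,3,4)]
    not_in_U_closure_imp_far_from_norm_2[OF assms(1,2) _ assms(3,4)]
  by blast

lemma exclusion_set_U_closure: "exclusion_set (U_closure t)"
  unfolding exclusion_set_def
proof (intro conjI ballI impI symmetric_U_closure without_redundancy_U_closure)
  fix b assume b: "b \<in> gaussian_cfs" and "\<not> cf_converges b"
  show "b \<in> Ex_set (U_closure t)"
  proof (rule ccontr)
    assume "b \<notin> Ex_set (U_closure t)"
    then obtain n
      where n: "\<And>x. x \<in> U_closure t \<Longrightarrow> \<not> substring_of_seq x (\<lambda>k. b (n + k))"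
      using b by (auto simp: Ex_set_def)
    \<comment> \<open>One more letter is dropped because
      \<open>cf_converges_if_tail_converges\<close> speaks of tails from an index
      \<open>Suc n\<close>. Words that occur in c still occur in the tail from n.\<close>
    define c where "c = (\<lambda>j. b (Suc n + j))"
    have c: "c j \<in> gaussian_ints" for j using b by (simp add: c_def gaussian_cfs_def)
    have "substring_of_seq [c j] (\<lambda>k. b (n + k))" for j
      unfolding substring_of_seq_def by (rule exI[of _ "Suc j"]) (simp add: c_def)
    then have "[c j] \<notin> U_closure t" for j using n by blast
    moreover have "[0] \<in> U_closure t" unfolding U_closure_def by (rule sym_closure.zero)
    ultimately have nz: "c j \<noteq> 0" for j by metis
    have "substring_of_seq [c j, c (Suc j)] (\<lambda>k. b (n + k))" for j
      unfolding substring_of_seq_def by (rule exI[of _ "Suc j"]) (simp add: c_def upt_rec)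
    then have nin: "[c j, c (Suc j)] \<notin> U_closure t" for j using n by blast
    have "c \<in> gaussian_cfs" using c by (simp add: gaussian_cfs_def)
    then have "(\<forall>k. cf_denom c (Suc k) \<noteq> 0) \<and> convergent (\<lambda>k. cf_num c k / cf_denom c k)"
      using nz not_in_U_closure_imp_admissible[OF c nz c nin] by (rule admissible_imp_converges)
    then have "cf_converges b" unfolding c_def by (intro cf_converges_if_tail_converges) auto
    then show False using \<open>\<not> cf_converges b\<close> by blast
  qed
qed

lemma U_closure_finite_reversible:
  "U_closure t \<in> finite_reversible_exclusion_sets 2"
  unfolding finite_reversible_exclusion_sets_def reversible_exclusion_set_def
  using finite_U_closure exclusion_set_U_closure U_closure_rev word_set_length_U_closure by blast

section \<open>Words that every exclusion set of length two has to meet\<close>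

definition meets :: "complex list set \<Rightarrow> complex list \<Rightarrow> bool" where
  "meets Y w \<longleftrightarrow> (\<exists>y\<in>Y. sublist y w)"

text \<open>For a unit, \<open>cnj u\<close> is the inverse of u; it evaluates on coordinates
  without division. Swapped pairs are included because the sets are closed under reversal.\<close>

definition same_orbit :: "complex \<times> complex \<Rightarrow> complex \<times> complex \<Rightarrow> bool" where
  "same_orbit p q \<longleftrightarrow> (\<exists>u\<in>gaussian_units. case p of (a, b) \<Rightarrow>
     q \<in> {(u * a, cnj u * b), (u * b, cnj u * a), (u * cnj a, cnj u * cnj b), (u * cnj b, cnj u * cnj a)})"

lemma bex_gaussian_units_iff: "(\<exists>u\<in>gaussian_units. P u) \<longleftrightarrow> P 1 \<or> P (-1) \<or> P \<i> \<or> P (-\<i>)"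
  by (auto simp: gaussian_units_def)

lemma substring_of_seq_iff: "substring_of_seq w f \<longleftrightarrow> (\<exists>r. \<forall>i<length w. w ! i = f (r + i))"
proof -
  have "w = map f [r..<r + length w] \<longleftrightarrow> (\<forall>i<length w. w ! i = f (r + i))"
    for r
    by (subst list_eq_iff_nth_eq) simp
  then show ?thesis unfolding substring_of_seq_def by (simp only:)
qed

locale length_two_exclusion_set =
  fixes Y :: "complex list set"
  assumes mem: "Y \<in> finite_reversible_exclusion_sets 2"
begin

lemma excl: "exclusion_set Y" "Y = sym_closure Y" "Y \<subseteq> words"
  and rev_closed: "y \<in> Y \<Longrightarrow> rev y \<in> Y"
  using mem by (auto simp: finite_reversible_exclusion_sets_def reversible_exclusion_set_def
      exclusion_set_def symmetric_word_set_def)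

lemma word_cases:
  assumes "y \<in> Y"
  shows "(\<exists>a. y = [a]) \<or> (\<exists>a b. y = [a, b])"
proof -
  have "enat (length y) \<le> word_set_length Y"
    unfolding word_set_length_def using assms by (rule SUP_upper)
  then have "length y \<le> 2" using mem
    by (simp add: finite_reversible_exclusion_sets_def numeral_eq_enat)
  moreover have "y \<noteq> []" using excl assms by (auto simp: words_def)
  ultimately show ?thesis by (cases y; cases "tl y") auto
qed

lemma zero_mem: "[0] \<in> Y"
  using excl(2) sym_closure.zero by metis

lemma twist_mem: "y \<in> Y \<Longrightarrow> u \<in> gaussian_units \<Longrightarrow> twist u y \<in> Y"
  using excl(2) sym_closure.twist by metis

lemma conj_mem: "y \<in> Y \<Longrightarrow> map cnj y \<in> Y"
  using excl(2) sym_closure.conj by metis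

lemma meets_pair_iff: "meets Y [a, b] \<longleftrightarrow> [a] \<in> Y \<or> [b] \<in> Y \<or> [a, b] \<in> Y"
proof
  assume "meets Y [a, b]"
  then obtain y where "y \<in> Y" "sublist y [a, b]" by (auto simp: meets_def)
  then show "[a] \<in> Y \<or> [b] \<in> Y \<or> [a, b] \<in> Y"
    using word_cases[of y] by (auto simp: sublist_Cons_right)
qed (auto simp: meets_def intro: bexI[of _ "[a]"] bexI[of _ "[b]"] bexI[of _ "[a, b]"])

lemma meets_twist: "meets Y [a, b] \<Longrightarrow> u \<in> gaussian_units \<Longrightarrow> meets Y [u * a, inverse u * b]"
  unfolding meets_pair_iff
    using twist_mem[of "[a]" u] twist_mem[of "[b]" "inverse u"] twist_mem[of "[a, b]" u]
    gaussian_unitsD(4)[of u] by auto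

lemma meets_cnj: "meets Y [a, b] \<Longrightarrow> meets Y [cnj a, cnj b]"
  unfolding meets_pair_iff using conj_mem[of "[a]"] conj_mem[of "[b]"] conj_mem[of "[a, b]"] by auto

lemma meets_swap: "meets Y [a, b] \<Longrightarrow> meets Y [b, a]"
  unfolding meets_pair_iff using rev_closed[of "[a, b]"] by auto

lemma meets_same_orbit:
  assumes "meets Y [a, b]" "same_orbit (a, b) (c, d)"
  shows "meets Y [c, d]"
proof -
  obtain u where u: "u \<in> gaussian_units" and
    "(c, d) \<in> {(u * a, cnj u * b), (u * b, cnj u * a), (u * cnj a, cnj u * cnj b), (u * cnj b, cnj u * cnj a)}"
    using assms(2) by (auto simp: same_orbit_def)
  then show ?thesis
    using meets_twist[OF _ u] meets_cnj meets_swap assms(1) gaussian_unitsD(5)[OF u] by auto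
qed

text \<open>The starting values of the two folds extend the recurrence to index -1, with numerator 0
  and denominator -1. The repeated head lets each fold end with the indices n and n + 1, where n is
  the period. Words of Y have at most two letters, so a word of Y in the divergent periodic fraction
  fits into a cyclically consecutive pair.\<close>

lemma meets_periodic:
  assumes ws: "ws \<noteq> []" "set ws \<subseteq> gaussian_ints"
    and num: "fold (\<lambda>a (p, q). (q, a * q - p)) (ws @ [hd ws]) (0, 1) = (s, s * hd ws)"
    and denom: "fold (\<lambda>a (p, q). (q, a * q - p)) (ws @ [hd ws]) (-1, 0) = (0, s)"
    and "s \<noteq> 0"
  shows "\<exists>(a, b)\<in>set (zip ws (tl ws @ [hd ws])). meets Y [a, b]"
proof -
  define n where "n = length ws"
  obtain m where m: "n = Suc m" using ws by (cases n) (auto simp: n_def)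
  define b where "b k = ws ! (k mod n)" for k
  have per: "b (k + Suc m) = b k" for k unfolding b_def m by (metis mod_add_self2)
  have fold_num: "fold (\<lambda>a (p, q). (q, a * q - p)) (map b [0..<Suc k]) (0, 1) = (cf_num b k, cf_num b (Suc k))"
    and fold_denom: "fold (\<lambda>a (p, q). (q, a * q - p)) (map b [0..<Suc k]) (-1, 0) = (cf_denom b k, cf_denom b (Suc k))" for k
    by (induction k) simp_all
  have b0: "b 0 = hd ws" using ws by (simp add: b_def hd_conv_nth)
  have map_b: "map b [0..<n] = ws" by (rule nth_equalityI) (auto simp: b_def n_def)
  have "b n = b 0" using per[of 0] by (simp add: m)
  then have map_b': "map b [0..<Suc n] = ws @ [hd ws]" using map_b b0 by simp
  have "cf_num b n = s" "cf_num b (Suc n) = s * hd ws"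
    using arg_cong[OF fold_num[of n], of fst] arg_cong[OF fold_num[of n], of snd]
    unfolding map_b' num fst_conv snd_conv by (metis, metis)
  moreover have "cf_denom b n = 0" "cf_denom b (Suc n) = s"
    using arg_cong[OF fold_denom[of n], of fst] arg_cong[OF fold_denom[of n], of snd]
    unfolding map_b' denom fst_conv snd_conv by (metis, metis)
  ultimately have "\<not> cf_converges b"
    using periodic_cf_diverges[of b m s, OF per] \<open>s \<noteq> 0\<close> unfolding m b0 by blast
  moreover have "b \<in> gaussian_cfs"
  proof -
    have "b k \<in> set ws" for k using ws by (simp add: b_def n_def)
    then show ?thesis using ws by (auto simp: gaussian_cfs_def)
  qed
  ultimately have "b \<in> Ex_set Y" using excl(1) by (auto simp: exclusion_set_def)
  then obtain y where y: "y \<in> Y" "substring_of_seq y (\<lambda>k. b (0 + k))"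
    unfolding Ex_set_def by blast
  then obtain r where r: "\<And>i. i < length y \<Longrightarrow> y ! i = b (r + i)"
    by (auto simp: substring_of_seq_iff)
  have "y = [b r] \<or> y = [b r, b (Suc r)]"
    using word_cases[OF y(1)] r[of 0] r[of 1] by auto
  then have "meets Y [b r, b (Suc r)]" using y(1) by (auto simp: meets_pair_iff)
  moreover have "(b r, b (Suc r)) \<in> set (zip ws (tl ws @ [hd ws]))"
  proof -
    have lt: "r mod n < n" by (simp add: m)
    have len: "length ws = Suc m" using m by (simp add: n_def)
    have "(tl ws @ [hd ws]) ! (r mod n) = b (Suc r)"
    proof (cases "r mod n = m")
      case True
      then have "Suc r mod n = 0" by (simp add: m mod_Suc)
      then show ?thesis using True b0 by (simp add: b_def nth_append len)
    next
      case False
      then have "Suc r mod n = Suc (r mod n)" by (simp add: m mod_Suc)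
      moreover have "r mod n < m" using False lt m by linarith
      ultimately show ?thesis by (simp add: b_def nth_append len nth_tl)
    qed
    then have "zip ws (tl ws @ [hd ws]) ! (r mod n) = (b r, b (Suc r))"
      using lt ws by (simp add: n_def b_def)
    moreover have "r mod n < length (zip ws (tl ws @ [hd ws]))" using lt ws by (simp add: n_def)
    ultimately show ?thesis by (metis nth_mem)
  qed
  ultimately show ?thesis by blast
qed

text \<open>Values are written with \<^const>\<open>Complex\<close> so that the simplifier evaluates the recurrence
  letter by letter.\<close>

lemma meets_periodic_orbits:
  assumes "ws \<noteq> []" "set ws \<subseteq> gaussian_ints"
    "fold (\<lambda>a (p, q). (q, a * q - p)) (ws @ [hd ws]) (Complex 0 0, Complex 1 0)
      = (Complex s 0, Complex s 0 * hd ws)"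
    "fold (\<lambda>a (p, q). (q, a * q - p)) (ws @ [hd ws]) (Complex (-1) 0, Complex 0 0)
      = (Complex 0 0, Complex s 0)"
    "s \<noteq> 0"
    and "\<forall>p\<in>set (zip ws (tl ws @ [hd ws])). same_orbit p (c, d) \<or> same_orbit p (c', d')"
  shows "meets Y [c, d] \<or> meets Y [c', d']"
proof -
  have eqs: "Complex 0 0 = 0" "Complex 1 0 = 1" "Complex (-1) 0 = -1"
    by (simp_all add: complex_eq_iff)
  have "Complex s 0 \<noteq> 0" using assms(5) by (simp add: complex_eq_iff)
  then show ?thesis
    using meets_periodic[OF assms(1,2) assms(3,4)[unfolded eqs]] assms(6) meets_same_orbit by blast
qed

lemma meets_periodic_orbit:
  assumes "ws \<noteq> []" "set ws \<subseteq> gaussian_ints"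
    "fold (\<lambda>a (p, q). (q, a * q - p)) (ws @ [hd ws]) (Complex 0 0, Complex 1 0)
      = (Complex s 0, Complex s 0 * hd ws)"
    "fold (\<lambda>a (p, q). (q, a * q - p)) (ws @ [hd ws]) (Complex (-1) 0, Complex 0 0)
      = (Complex 0 0, Complex s 0)"
    "s \<noteq> 0"
    and "\<forall>p\<in>set (zip ws (tl ws @ [hd ws])). same_orbit p (c, d)"
  shows "meets Y [c, d]"
  using meets_periodic_orbits[OF assms(1-5), of c d c d] assms(6) by simp

lemmas complex_eval = complex_mult complex_diff complex_minus Complex_eq_0 gaussian_ints_def
  same_orbit_def bex_gaussian_units_iff complex_eq_iff

text \<open>Each period consists of copies of a short block, in some cases twisted by successive
  powers of i. The block, combined with that twist, acts on the sphere with finite order, and the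
  period runs through enough copies to make the product \<plusminus>1.\<close>

lemma meets_common_pair:
  assumes "(c, d) \<in> common_pairs"
  shows "meets Y [c, d]"
proof -
  have "meets Y [1, 1]"
    by (rule meets_periodic_orbit[where s = "-1" and
          ws = "[Complex 1 0, Complex 1 0, Complex 1 0]"])
      (simp_all add: complex_eval)
  moreover have "meets Y [1, 2]"
    by (rule meets_periodic_orbit[where s = "-1" and
          ws = "[Complex 1 0, Complex 2 0, Complex 1 0, Complex 2 0]"])
      (simp_all add: complex_eval)
  moreover have "meets Y [1, 3]"
    by (rule meets_periodic_orbit[where s = "-1" and
          ws = "[Complex 1 0, Complex 3 0, Complex 1 0, Complex 3 0, Complex 1 0, Complex 3 0]"])
      (simp_all add: complex_eval)
  moreover have "meets Y [1, \<i>]"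
    by (rule meets_periodic_orbit[where s = "-1" and
          ws = "[Complex 1 0, Complex 0 1, Complex (-1) 0, Complex 0 (-1), Complex 1 0, Complex 0 1,
            Complex (-1) 0, Complex 0 (-1), Complex 1 0, Complex 0 1, Complex (-1) 0,
            Complex 0 (-1)]"])
      (simp_all add: complex_eval)
  moreover have "meets Y [1, 1 + \<i>]"
    by (rule meets_periodic_orbit[where s = "-1" and
          ws = "[Complex 1 0, Complex 1 (-1), Complex 1 0, Complex 1 1, Complex 1 0, Complex 1 (-1),
            Complex 1 0, Complex 1 1]"])
      (simp_all add: complex_eval)
  moreover have "meets Y [1, 2 + \<i>]"
    by (rule meets_periodic_orbit[where s = "1" and
          ws = "[Complex 1 0, Complex 2 (-1), Complex 1 0, Complex 2 1, Complex 1 0, Complex 2 (-1),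
            Complex 1 0, Complex 2 1, Complex 1 0, Complex 2 (-1), Complex 1 0, Complex 2 1]"])
      (simp_all add: complex_eval)
  moreover have "meets Y [1, 3 + \<i>]"
    by (rule meets_periodic_orbit[where s = "-1" and
          ws = "[Complex 1 0, Complex 3 (-1), Complex 1 0, Complex 3 1, Complex 1 0, Complex 3 (-1),
            Complex 1 0, Complex 3 1]"])
      (simp_all add: complex_eval)
  moreover have "meets Y [1, 2 + 2 * \<i>]"
    by (rule meets_periodic_orbit[where s = "1" and
          ws = "[Complex 1 0, Complex 2 (-2), Complex 0 1, Complex (-2) (-2), Complex (-1) 0,
            Complex (-2) 2, Complex 0 (-1), Complex 2 2]"])
      (simp_all add: complex_eval)
  moreover have "meets Y [1 + \<i>, 1 - \<i>]"
    by (rule meets_periodic_orbit[where s = "-1" and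
          ws = "[Complex 1 1, Complex 1 (-1), Complex 1 1, Complex 1 (-1)]"])
      (simp_all add: complex_eval)
  moreover have "meets Y [1 + \<i>, 2]"
    by (rule meets_periodic_orbit[where s = "1" and
          ws = "[Complex 1 1, Complex 2 0, Complex 1 (-1), Complex 0 2, Complex (-1) (-1),
            Complex (-2) 0, Complex (-1) 1, Complex 0 (-2)]"])
      (simp_all add: complex_eval)
  moreover have "meets Y [1 + \<i>, 2 - \<i>]"
    by (rule meets_periodic_orbit[where s = "-1" and
          ws = "[Complex 1 1, Complex 2 (-1), Complex 1 1, Complex 1 (-2), Complex 1 1,
            Complex 2 (-1), Complex 1 1, Complex 1 (-2)]"])
      (simp_all add: complex_eval)
  ultimately show ?thesis using assms unfolding common_pairs_def by blast
qed

text \<open>The period is the block 1 + 2i, 1, 1 - 2i, -1 + i followed by its twists by i, -1 and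
  -i. The unit letters have neighbours from the orbit of {1, 1 + 2i}; the letters of norm 2 join
  consecutive units' neighbours through pairs from the orbit of {1 + i, 2 + i}.\<close>

lemma meets_special_pair:
  "\<exists>t. meets Y [fst (special_pair t), snd (special_pair t)]"
proof -
  have "meets Y [1, 1 + 2 * \<i>] \<or> meets Y [1 + \<i>, 2 + \<i>]"
    by (rule meets_periodic_orbits[where s = 1 and
          ws = "[Complex 1 2, Complex 1 0, Complex 1 (-2), Complex (-1) 1, Complex (-2) 1,
            Complex 0 (-1), Complex 2 1, Complex 1 1, Complex (-1) (-2), Complex (-1) 0,
            Complex (-1) 2, Complex 1 (-1), Complex 2 (-1), Complex 0 1, Complex (-2) (-1),
            Complex (-1) (-1)]"])
      (simp_all add: complex_eval)
  then show ?thesis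
    by (intro exI[of _ "\<not> meets Y [1, 1 + 2 * \<i>]"]) (auto simp: special_pair_def)
qed

lemma meets_U_closure: "\<exists>t. \<forall>w\<in>U_closure t. meets Y w"
proof -
  obtain t where t: "meets Y [fst (special_pair t), snd (special_pair t)]" using meets_special_pair
    by blast
  have "meets Y w" if w: "w \<in> U_closure t" for w
  proof -
    have "w = [0] \<or> (\<exists>a b. w = [a, b] \<and> meets Y [a, b])"
    proof (rule sym_closure_pairs[OF w[unfolded U_closure_def]])
      fix w assume "w \<in> U_words t"
      then obtain p
        where p: "p \<in> insert (special_pair t) common_pairs" "w \<in> (case p of (a, b) \<Rightarrow> {[a, b], [b, a]})"
        unfolding U_words_eq by (rule UN_E)
      then have "meets Y [fst p, snd p]" using t meets_common_pair by (metis insertE prod.collapse)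
      then show "\<exists>a b. w = [a, b] \<and> meets Y [a, b]" using p(2) meets_swap
        by (cases p) auto
    qed (use meets_cnj meets_twist in auto)
    then show ?thesis using zero_mem by (auto simp: meets_def)
  qed
  then show ?thesis by blast
qed

end


section \<open>Comparison of exclusion sets\<close>

lemma substring_of_seq_sublist:
  assumes "substring_of_seq x f" "sublist y x"
  shows "substring_of_seq y f"
proof -
  obtain r where r: "\<And>i. i < length x \<Longrightarrow> x ! i = f (r + i)" using assms(1)
    by (auto simp: substring_of_seq_iff)
  obtain p s where x: "x = p @ y @ s" using assms(2) by (auto simp: sublist_def)
  have "y ! i = f (r + length p + i)" if "i < length y" for i
    using r[of "length p + i"] that by (simp add: x nth_append add_ac)
  then show ?thesis by (auto simp: substring_of_seq_iff)
qed

lemma Ex_set_mono: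
  assumes "\<And>x. x \<in> X \<Longrightarrow> meets Y x"
  shows "Ex_set X \<subseteq> Ex_set Y"
proof
  fix b assume b: "b \<in> Ex_set X"
  have "\<exists>y\<in>Y. substring_of_seq y (\<lambda>k. b (n + k))" for n
  proof -
    obtain x where x: "x \<in> X" "substring_of_seq x (\<lambda>k. b (n + k))" using b
      unfolding Ex_set_def by blast
    obtain y where "y \<in> Y" "sublist y x" using assms[OF x(1)] unfolding meets_def by blast
    then show ?thesis using substring_of_seq_sublist[OF x(2)] by blast
  qed
  then show "b \<in> Ex_set Y" using b unfolding Ex_set_def by blast
qed

text \<open>The periodic continued fraction with period \<open>w\<close> followed by a letter that occurs in no word
  of \<open>Y\<close> contains only substrings of \<open>w\<close> from \<open>Y\<close>.\<close>

lemma Ex_set_subset_imp_meets: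
  assumes "finite Y" "X \<subseteq> words" "Ex_set X \<subseteq> Ex_set Y" "w \<in> X"
  shows "meets Y w"
proof -
  have "finite (\<Union>y\<in>Y. set y)" using assms(1) by auto
  moreover have "infinite (range complex_of_nat)" by (simp add: finite_image_iff inj_of_nat)
  ultimately have "\<not> range complex_of_nat \<subseteq> (\<Union>y\<in>Y. set y)"
    using finite_subset by blast
  then obtain N :: nat where N: "of_nat N \<notin> (\<Union>y\<in>Y. set y)" by blast
  define L where "L = length w"
  define b where "b k = (w @ [of_nat N]) ! (k mod Suc L)" for k
  have w: "set w \<subseteq> gaussian_ints" using assms(2,4) by (auto simp: words_def)
  have "b \<in> gaussian_cfs"
  proof -
    have "b k \<in> set (w @ [of_nat N])" for k unfolding b_def by (rule nth_mem) (simp add: L_def)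
    moreover have "set (w @ [of_nat N]) \<subseteq> gaussian_ints" using w
      by (auto simp: gaussian_ints_def)
    ultimately show ?thesis unfolding gaussian_cfs_def by blast
  qed
  moreover have "substring_of_seq w (\<lambda>k. b (n + k))" for n
    unfolding substring_of_seq_iff
  proof (intro exI allI impI)
    fix i assume i: "i < length w"
    \<comment> \<open>Position n L of the tail from n is position n (L + 1) of b, the start of a
      period.\<close>
    have "n + (n * L + i) = i + n * Suc L" by simp
    then have "(n + (n * L + i)) mod Suc L = i" using i
      by (simp only: mod_mult_self1) (simp add: L_def)
    then show "w ! i = b (n + (n * L + i))"
      using i by (simp add: b_def nth_append)
  qed
  ultimately have "b \<in> Ex_set X" using assms(4) by (auto simp: Ex_set_def)
  then have "b \<in> Ex_set Y" using assms(3) by blast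
  then obtain y where y: "y \<in> Y" "substring_of_seq y (\<lambda>k. b (0 + k))"
    unfolding Ex_set_def by blast
  then obtain r where r: "\<And>i. i < length y \<Longrightarrow> y ! i = b (r + i)"
    by (auto simp: substring_of_seq_iff)
  define q where "q = r mod Suc L"
  \<comment> \<open>Otherwise y would run across the letter N that closes the period.\<close>
  have "q + length y \<le> L"
  proof (rule ccontr)
    assume "\<not> ?thesis"
    moreover have "q \<le> L" by (simp add: q_def less_Suc_eq_le[symmetric])
    ultimately have i: "L - q < length y" "q + (L - q) = L" by auto
    have "(r + (L - q)) mod Suc L = (q + (L - q)) mod Suc L"
      unfolding q_def by (rule mod_add_left_eq[symmetric])
    then have m: "(r + (L - q)) mod Suc L = L mod Suc L" unfolding i(2) .
    then have "b (r + (L - q)) = of_nat N" unfolding b_def m by (simp add: L_def)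
    moreover have "y ! (L - q) = b (r + (L - q))" using r i by simp
    ultimately have "of_nat N \<in> set y" using i nth_mem by metis
    then show False using N y(1) by blast
  qed
  have "y = take (length y) (drop q w)"
  proof (rule nth_equalityI)
    show "length y = length (take (length y) (drop q w))" using \<open>q + length y \<le> L\<close>
      by (simp add: L_def)
    fix i assume i: "i < length y"
    have "(r + i) mod Suc L = (q + i) mod Suc L" by (simp add: q_def mod_add_left_eq)
    then have "b (r + i) = w ! (q + i)"
      using i \<open>q + length y \<le> L\<close> by (simp add: b_def nth_append L_def)
    moreover have "y ! i = b (r + i)" using r i by simp
    ultimately show "y ! i = take (length y) (drop q w) ! i"
      using i \<open>q + length y \<le> L\<close> by (simp add: L_def)
  qed
  then have "sublist y w" by (metis sublist_drop sublist_order.order_trans sublist_take)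
  then show ?thesis using y(1) by (auto simp: meets_def)
qed

text \<open>A word x of one set contains a word z of the other, which contains a word x' of the
  first. Absence of redundancy gives x' = x, hence z = x.\<close>

lemma eq_if_mutually_meet:
  assumes "without_redundancy X" "without_redundancy Y"
    and XY: "\<And>x. x \<in> X \<Longrightarrow> meets Y x" and YX: "\<And>y. y \<in> Y \<Longrightarrow> meets X y"
  shows "X = Y"
proof -
  have *: "A \<subseteq> B"
    if A: "without_redundancy A" "\<forall>x\<in>A. meets B x" "\<forall>y\<in>B. meets A y" for A B
  proof
    fix x assume "x \<in> A"
    obtain z where z: "z \<in> B" "sublist z x" using A(2) \<open>x \<in> A\<close>
      unfolding meets_def by blast
    obtain x' where x': "x' \<in> A" "sublist x' z" using A(3) z(1) unfolding meets_def by blast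
    have "sublist x' x" using x'(2) z(2) by (rule sublist_order.order_trans)
    then have "x' = x" using A(1) \<open>x \<in> A\<close> x'(1) unfolding without_redundancy_def
      by blast
    then have "z = x" using x'(2) z(2) sublist_order.order_antisym by blast
    then show "x \<in> B" using z(1) by simp
  qed
  show ?thesis
  proof
    show "X \<subseteq> Y" using assms(1) by (rule *) (use XY YX in blast)+
    show "Y \<subseteq> X" using assms(2) by (rule *) (use XY YX in blast)+
  qed
qed

text \<open>Minimality is stated with equality of sets of words, while the order only compares their
  \<open>Ex_set\<close>s; this lemma bridges the two.\<close>

lemma exclusion_le_antisym:
  assumes X: "X \<in> finite_reversible_exclusion_sets l" and Y: "Y \<in> finite_reversible_exclusion_sets l"
    and "exclusion_le X Y" "exclusion_le Y X"
  shows "X = Y"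
proof (rule eq_if_mutually_meet)
  note defs = finite_reversible_exclusion_sets_def reversible_exclusion_set_def exclusion_set_def
    symmetric_word_set_def exclusion_le_def
  show "without_redundancy X" "without_redundancy Y" using X Y by (auto simp: defs)
  show "meets Y x" if "x \<in> X" for x
    by (rule Ex_set_subset_imp_meets[OF _ _ _ that]) (use assms in \<open>auto simp: defs\<close>)
  show "meets X y" if "y \<in> Y" for y
    by (rule Ex_set_subset_imp_meets[OF _ _ _ that]) (use assms in \<open>auto simp: defs\<close>)
qed

lemma exclusion_le_U_closure:
  assumes "Y \<in> finite_reversible_exclusion_sets 2"
  shows "\<exists>t. exclusion_le (U_closure t) Y"
proof -
  interpret length_two_exclusion_set Y by standard (rule assms)
  show ?thesis unfolding exclusion_le_def using meets_U_closure Ex_set_mono by meson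
qed

text \<open>The special pair of one set has no letter 0, so the other closure can meet it only by
  containing it, which the invariant \<open>U_shape\<close> forbids for s \<noteq> t.\<close>

lemma U_closure_incomparable:
  assumes "exclusion_le (U_closure s) (U_closure t)"
  shows "s = t"
proof -
  define w where "w = [fst (special_pair s), snd (special_pair s)]"
  have w: "w \<in> U_closure s" by (simp add: w_def special_pair_in_U_closure_iff)
  have "U_closure s \<subseteq> words" using symmetric_U_closure
    by (auto simp: symmetric_word_set_def)
  then have "meets (U_closure t) w"
    using Ex_set_subset_imp_meets[OF finite_U_closure] assms w unfolding exclusion_le_def by blast
  then obtain y where y: "y \<in> U_closure t" "sublist y w" by (auto simp: meets_def)
  moreover have "0 \<notin> set w" by (cases s) (auto simp: w_def special_pair_def complex_eq_iff)
  ultimately have "y = w" using U_closure_cases[of y t] by (auto simp: w_def sublist_Cons_right)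
  then show "s = t" using y(1) by (simp add: w_def special_pair_in_U_closure_iff)
qed

theorem theoremD:
  shows "{X. minimal_reversible_exclusion_set 2 X} = {sym_closure U1, sym_closure U2} \<and>
         sym_closure U1 \<noteq> sym_closure U2"
proof -
  have U: "sym_closure U1 = U_closure False" "sym_closure U2 = U_closure True"
    by (simp_all add: U_closure_def U_words_def)
  have "minimal_reversible_exclusion_set 2 X \<longleftrightarrow> (\<exists>t. X = U_closure t)"
    for X
  proof
    assume min: "minimal_reversible_exclusion_set 2 X"
    then obtain t where "exclusion_le (U_closure t) X"
      using exclusion_le_U_closure by (auto simp: minimal_reversible_exclusion_set_def)
    then have "U_closure t = X"
      using min U_closure_finite_reversible by (auto simp: minimal_reversible_exclusion_set_def)
    then show "\<exists>t. X = U_closure t" by blast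
  next
    assume "\<exists>t. X = U_closure t"
    then obtain t where t: "X = U_closure t" by blast
    have "Y = X" if Y: "Y \<in> finite_reversible_exclusion_sets 2" "exclusion_le Y X" for Y
    proof -
      obtain s where s: "exclusion_le (U_closure s) Y" using exclusion_le_U_closure Y(1) by blast
      then have "exclusion_le (U_closure s) (U_closure t)" using Y(2) t
        by (auto simp: exclusion_le_def)
      then have "s = t" by (rule U_closure_incomparable)
      then show ?thesis
        using exclusion_le_antisym[OF Y(1) _ Y(2)] s t U_closure_finite_reversible by blast
    qed
    then show "minimal_reversible_exclusion_set 2 X"
      using t U_closure_finite_reversible by (auto simp: minimal_reversible_exclusion_set_def)
  qed
  then have "{X. minimal_reversible_exclusion_set 2 X} = {U_closure False, U_closure True}"
    by (auto simp: ex_bool_eq)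
  moreover have "U_closure False \<noteq> U_closure True" using special_pair_in_U_closure_iff
    by metis
  ultimately show ?thesis by (simp add: U)
qed

end
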